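(* For $\nu\in\mathbb{Q}_{>0}$, $\nu\neq 1$, let $E_\nu$ be the elliptic curve over $\mathbb{Q}$ given by $y^2=x(x+1)(x+\nu^2)$. Then the set $$\Gamma=\{\nu\in\mathbb{Q}_{>0}\setminus\{1\}:\ \text{the elliptic curve } E_\nu \text{ has positive rank}\}$$ is dense in $\mathbb{R}_{>0}$ in the Euclidean topology.
   Context: The rank of an elliptic curve $E$ over $\mathbb{Q}$ is the rank of the finitely generated abelian group $E(\mathbb{Q})$; positive rank means that $E(\mathbb{Q})$ contains a point of infinite order. *)

theory Defs
  imports
    "HOL-Analysis.Analysis"
    "HOL-Algebra.FiniteProduct"
    "HOL-Computational_Algebra.Squarefree"
    "HOL-Library.Extended_Nat"
begin

section \<open>Rank of an abelian group\<close>

definition int_independent :: "('a, 'b) monoid_scheme \<Rightarrow> 'a set \<Rightarrow> bool" where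
  "int_independent G S \<longleftrightarrow> finite S \<and> S \<subseteq> carrier G \<and>
     (\<forall>c :: 'a \<Rightarrow> int. finprod G (\<lambda>x. x [^]\<^bsub>G\<^esub> c x) S = \<one>\<^bsub>G\<^esub> \<longrightarrow> (\<forall>x\<in>S. c x = 0))"

text \<open>The value is an extended natural number so that the definition does not presuppose
  finite generation; for a finitely generated group it is the rank of its free part.\<close>

definition abelian_rank :: "('a, 'b) monoid_scheme \<Rightarrow> enat" where
  "abelian_rank G = (SUP S\<in>{S. int_independent G S}. enat (card S))"

lemma (in comm_group) abelian_rank_pos_iff:
  "0 < abelian_rank G \<longleftrightarrow> (\<exists>x\<in>carrier G. \<forall>n::nat. 0 < n \<longrightarrow> x [^] n \<noteq> \<one>)"
proof
  assume "0 < abelian_rank G"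
  then obtain S where S: "int_independent G S" "card S > 0"
    unfolding abelian_rank_def by (auto simp: less_SUP_iff zero_enat_def)
  then obtain x where x: "x \<in> S" "finite S" "S \<subseteq> carrier G"
    by (auto simp: int_independent_def card_gt_0_iff)
  have "x [^] n \<noteq> \<one>" if "0 < n" for n :: nat
  proof
    assume n: "x [^] n = \<one>"
    have "finprod G (\<lambda>y. y [^] (if y = x then int n else 0)) S = \<one>"
      by (rule finprod_one_eqI) (auto simp: int_pow_int n)
    moreover have "\<forall>c :: 'a \<Rightarrow> int. finprod G (\<lambda>y. y [^] c y) S = \<one> \<longrightarrow> (\<forall>y\<in>S. c y = 0)"
      using S(1) by (simp add: int_independent_def)
    ultimately have "\<forall>z\<in>S. (if z = x then int n else 0) = 0"
      by (rule spec[where x = "\<lambda>z. if z = x then int n else 0", THEN mp, rotated])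
    with x(1) that show False by auto
  qed
  with x show "\<exists>x\<in>carrier G. \<forall>n::nat. 0 < n \<longrightarrow> x [^] n \<noteq> \<one>" by blast
next
  assume "\<exists>x\<in>carrier G. \<forall>n::nat. 0 < n \<longrightarrow> x [^] n \<noteq> \<one>"
  then obtain x where x: "x \<in> carrier G" "\<And>n::nat. 0 < n \<Longrightarrow> x [^] n \<noteq> \<one>" by blast
  have "k = 0" if "x [^] (k::int) = \<one>" for k
  proof (rule ccontr)
    assume "k \<noteq> 0"
    have "x [^] nat \<bar>k\<bar> = \<one>"
    proof (cases "k < 0")
      case True
      hence "inv (x [^] nat (- k)) = \<one>"
        using that by (simp only: int_pow_def2 if_True)
      thus ?thesis
        using True x(1) by simp
    next
      case False
      thus ?thesis
        using that by (simp only: int_pow_def2 if_False) simp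
    qed
    with x(2)[of "nat \<bar>k\<bar>"] \<open>k \<noteq> 0\<close> show False by simp
  qed
  hence "int_independent G {x}"
    using x(1) by (auto simp: int_independent_def)
  hence "enat (card {x}) \<le> abelian_rank G"
    unfolding abelian_rank_def by (intro SUP_upper) auto
  hence "1 \<le> abelian_rank G"
    by (simp add: one_enat_def)
  moreover have "(0::enat) < 1"
    by simp
  ultimately show "0 < abelian_rank G"
    by (rule less_le_trans[rotated])
qed


section \<open>Elliptic curves $y^2 = f(x)$\<close>

text \<open>In characteristic zero, squarefree means that \<open>f\<close> has no repeated root in an algebraic closure,
  i.e. that the curve is smooth.\<close>

definition elliptic_cubic :: "'a :: field_char_0 poly \<Rightarrow> bool" where
  "elliptic_cubic f \<longleftrightarrow> degree f = 3 \<and> lead_coeff f = 1 \<and> squarefree f"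

datatype 'a point = Infinity | Affine 'a 'a

definition points :: "'a :: field_char_0 poly \<Rightarrow> 'a point set" where
  "points f = insert Infinity {Affine x y | x y. y\<^sup>2 = poly f x}"

text \<open>Chord-tangent law with neutral element \<^const>\<open>Infinity\<close>. The line of slope \<open>l\<close> through the
  two points meets the curve in three points whose \<open>x\<close>-coordinates sum to
  \<open>l\<^sup>2 - coeff f 2\<close>; the third of them is reflected in the \<open>x\<close>-axis.\<close>

fun point_add :: "'a :: field_char_0 poly \<Rightarrow> 'a point \<Rightarrow> 'a point \<Rightarrow> 'a point" where
  "point_add f Infinity Q = Q"
| "point_add f P Infinity = P"
| "point_add f (Affine x1 y1) (Affine x2 y2) =
     (if x1 = x2 \<and> y1 = - y2 then Infinity
      else let l = (if x1 = x2 then poly (pderiv f) x1 / (2 * y1) else (y2 - y1) / (x2 - x1));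
               x3 = l\<^sup>2 - coeff f 2 - x1 - x2
           in Affine x3 (l * (x1 - x3) - y1))"

definition point_group :: "'a :: field_char_0 poly \<Rightarrow> 'a point monoid" where
  "point_group f = \<lparr>carrier = points f, mult = point_add f, one = Infinity\<rparr>"

definition elliptic_rank :: "rat poly \<Rightarrow> enat" where
  "elliptic_rank f = abelian_rank (point_group f)"

definition E_curve :: "rat \<Rightarrow> rat poly" where
  "E_curve \<nu> = [:0, 1:] * [:1, 1:] * [:\<nu>\<^sup>2, 1:]"

lemma points_E_curve: "points (E_curve \<nu>) = insert Infinity {Affine x y | x y. y\<^sup>2 = x * (x + 1) * (x + \<nu>\<^sup>2)}"
  by (simp add: points_def E_curve_def algebra_simps)

lemma elliptic_cubic_E_curve:
  assumes "0 < \<nu>" "\<nu> \<noteq> 1"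
  shows "elliptic_cubic (E_curve \<nu>)"
proof -
  have nu: "\<nu>\<^sup>2 \<noteq> 1" "\<nu>\<^sup>2 \<noteq> 0"
    using assms by (auto simp: power2_eq_1_iff)
  have deg: "degree (E_curve \<nu>) = 3" and nz: "E_curve \<nu> \<noteq> 0"
    by (simp_all add: E_curve_def)
  have "squarefree (E_curve \<nu>)"
  proof (rule squarefreeI)
    fix p assume p: "p\<^sup>2 dvd E_curve \<nu>"
    with nz have "p \<noteq> 0" by auto
    moreover have "degree (p\<^sup>2) \<le> 3"
      using dvd_imp_degree_le[OF p nz] deg by simp
    ultimately have "degree p \<le> 1"
      by (simp add: degree_power_eq)
    moreover have "degree p \<noteq> 1"
    proof
      assume "degree p = 1"
      then obtain a b where ab: "p = [:a, b:]" "b \<noteq> 0"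
        by (cases p) (auto split: if_splits elim!: degree_eq_zeroE)
      define r where "r = - a / b"
      have r: "poly p r = 0"
        using ab by (simp add: r_def)
      from p obtain q where q: "E_curve \<nu> = p\<^sup>2 * q" by blast
      have "poly (E_curve \<nu>) r = 0"
        by (simp add: q r)
      hence 1: "r = 0 \<or> r = - 1 \<or> r = - \<nu>\<^sup>2"
        unfolding E_curve_def poly_mult mult_eq_0_iff by (auto simp: eq_neg_iff_add_eq_0 add.commute)
      have "poly (pderiv (E_curve \<nu>)) r = 0"
        by (simp add: q r pderiv_mult power2_eq_square)
      hence 2: "3 * r * r + 2 * (1 + \<nu>\<^sup>2) * r + \<nu>\<^sup>2 = 0"
        by (simp add: E_curve_def pderiv_pCons algebra_simps)
      have "\<nu>\<^sup>2 * (\<nu>\<^sup>2 - 1) = 0 \<or> \<nu>\<^sup>2 - 1 = 0 \<or> \<nu>\<^sup>2 = 0"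
        using 1 2 by (elim disjE) (simp_all add: algebra_simps)
      with nu show False by simp
    qed
    ultimately have "degree p = 0" by simp
    with \<open>p \<noteq> 0\<close> show "p dvd 1"
      by (simp add: is_unit_iff_degree)
  qed
  thus ?thesis
    by (simp add: elliptic_cubic_def E_curve_def numeral_3_eq_3)
qed

definition Gamma_set :: "rat set" where
  "Gamma_set = {\<nu>. 0 < \<nu> \<and> \<nu> \<noteq> 1 \<and> 0 < elliptic_rank (E_curve \<nu>)}"

end

theory Submission
  imports Defs
begin

text \<open>
  A point of infinite order is exhibited on \<open>E\<^sub>\<nu>\<close> for a dense set of \<open>\<nu>\<close>.

  Since \<open>(4/3)\<^sup>2 + 1 = (5/3)\<^sup>2\<close>, the value \<open>x = (4/3)\<^sup>2\<close> is the abscissa of a rational point as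
  soon as \<open>(4/3)\<^sup>2 + \<nu>\<^sup>2\<close> is a square, and Pythagorean triples parametrise these \<open>\<nu>\<close> as
  \<open>\<nu> = 2 (b\<^sup>2 - a\<^sup>2) / (3 a b)\<close>. If \<open>a\<close> and \<open>b\<close> are congruent to 1 modulo 3, then \<open>\<nu>\<close> is
  3-integral, whereas \<open>x\<close> has 3 in its denominator: the point lies in the kernel of reduction
  modulo 3. That kernel is torsion-free, so the point has infinite order. The quotients \<open>a / b\<close>
  with \<open>a\<close> and \<open>b\<close> congruent to 1 modulo 3 are dense in \<open>(0, 1)\<close>, and \<open>\<nu>\<close> depends on \<open>a / b\<close>
  through a continuous surjection of \<open>(0, 1)\<close> onto \<open>(0, \<infinity>)\<close>; so these \<open>\<nu>\<close> are dense.

  The torsion argument needs associativity, but only inside the kernel of reduction, and there an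
  easier model of the group is at hand. The substitution \<open>X = x / y\<close>, \<open>Y = (x - \<nu>) / (x + \<nu>)\<close>
  turns \<open>E\<^sub>\<nu>\<close> into the twisted Edwards curve \<open>a X\<^sup>2 + Y\<^sup>2 = 1 + d X\<^sup>2 Y\<^sup>2\<close> with
  \<open>a = (1 + \<nu>)\<^sup>2\<close> and \<open>d = (1 - \<nu>)\<^sup>2\<close>, and the kernel of reduction at \<open>p\<close> into the points with
  \<open>X \<equiv> 0\<close> and \<open>Y \<equiv> 1\<close> modulo \<open>p\<close>. For these points the denominators in the Edwards
  addition law are \<open>p\<close>-adic units, so one formula covers all cases and associativity is a single
  polynomial identity. Moreover \<open>X(P + Q) \<equiv> X(P) + X(Q)\<close> modulo \<open>p\<^sup>3\<^sup>k\<close> when \<open>p\<^sup>k\<close> divides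
  \<open>X(P)\<close> and \<open>X(Q)\<close>, whence multiplication by \<open>n\<close> cannot kill a nonzero point
  (\<open>torsion_free\<close>). The map back to the cubic carries Edwards addition to the chord-tangent
  law (\<open>to_cubic_add\<close>), which transports the infinite order to \<open>E\<^sub>\<nu>\<close>.
\<close>

section \<open>Powers of an odd prime in the local ring of rational numbers\<close>

locale odd_prime =
  fixes p :: int
  assumes prime: "prime p" and odd: "odd p"
begin

text \<open>The ideal generated by \<open>p\<^sup>k\<close> in the ring of \<open>p\<close>-integral rationals, which is \<open>pideal 0\<close>
  itself. Membership replaces \<open>p\<close>-adic valuations, so that 0 needs no special treatment.\<close>

definition pideal :: "nat \<Rightarrow> rat set" where
  "pideal k = {of_int (p ^ k * m) / of_int n | m n. \<not> p dvd n}"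

lemma pidealI: "\<not> p dvd n \<Longrightarrow> x = of_int (p ^ k * m) / of_int n \<Longrightarrow> x \<in> pideal k"
  unfolding pideal_def by blast

lemma p_nonzero: "(of_int p :: rat) \<noteq> 0"
  using prime by auto

lemma not_dvd_imp_nonzero: "\<not> p dvd n \<Longrightarrow> (of_int n :: rat) \<noteq> 0"
  by auto

lemma pideal_mult:
  assumes "x \<in> pideal j" "y \<in> pideal k" shows "x * y \<in> pideal (j + k)"
proof -
  obtain m n where x: "\<not> p dvd n" "x = of_int (p ^ j * m) / of_int n"
    using assms(1) unfolding pideal_def by blast
  obtain m' n' where y: "\<not> p dvd n'" "y = of_int (p ^ k * m') / of_int n'"
    using assms(2) unfolding pideal_def by blast
  have "x * y = of_int (p ^ (j + k) * (m * m')) / of_int (n * n')"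
    by (simp add: x y power_add)
  moreover have "\<not> p dvd n * n'"
    using x y prime by (simp add: prime_dvd_mult_iff)
  ultimately show ?thesis by (rule pidealI[rotated])
qed

lemma pideal_add:
  assumes "x \<in> pideal k" "y \<in> pideal k" shows "x + y \<in> pideal k"
proof -
  obtain m n where x: "\<not> p dvd n" "x = of_int (p ^ k * m) / of_int n"
    using assms(1) unfolding pideal_def by blast
  obtain m' n' where y: "\<not> p dvd n'" "y = of_int (p ^ k * m') / of_int n'"
    using assms(2) unfolding pideal_def by blast
  have "x + y = of_int (p ^ k * (m * n' + m' * n)) / of_int (n * n')"
    using not_dvd_imp_nonzero[OF x(1)] not_dvd_imp_nonzero[OF y(1)]
    by (simp add: x y field_simps)
  moreover have "\<not> p dvd n * n'"
    using x y prime by (simp add: prime_dvd_mult_iff)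
  ultimately show ?thesis by (rule pidealI[rotated])
qed

lemma of_int_pideal_0: "of_int m \<in> pideal 0"
  using prime by (intro pidealI[of 1 _ 0 m]) (auto simp: not_prime_unit)

lemma one_pideal_0: "1 \<in> pideal 0"
  using of_int_pideal_0[of 1] by simp

lemma pideal_mult_left: "c \<in> pideal 0 \<Longrightarrow> x \<in> pideal k \<Longrightarrow> c * x \<in> pideal k"
  using pideal_mult[of c 0 x k] by simp

lemma pideal_mult_right: "x \<in> pideal k \<Longrightarrow> c \<in> pideal 0 \<Longrightarrow> x * c \<in> pideal k"
  using pideal_mult[of x k c 0] by simp

lemma pideal_minus: "x \<in> pideal k \<Longrightarrow> - x \<in> pideal k"
  using pideal_mult_left[OF of_int_pideal_0[of "- 1"], of x k] by simp

lemma pideal_diff: "x \<in> pideal k \<Longrightarrow> y \<in> pideal k \<Longrightarrow> x - y \<in> pideal k"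
  using pideal_add[OF _ pideal_minus, of x k y] by simp

lemma zero_pideal: "0 \<in> pideal k"
  using prime by (intro pidealI[of 1 _ k 0]) (auto simp: not_prime_unit)

lemma pideal_antimono:
  assumes "j \<le> k" "x \<in> pideal k" shows "x \<in> pideal j"
proof -
  obtain m n where x: "\<not> p dvd n" "x = of_int (p ^ k * m) / of_int n"
    using assms(2) unfolding pideal_def by blast
  have "x = of_int (p ^ j * (p ^ (k - j) * m)) / of_int n"
    using assms(1) by (simp add: x mult.assoc[symmetric] power_add[symmetric])
  thus ?thesis using x(1) by (rule pidealI[rotated])
qed

lemma pideal_power2: "x \<in> pideal k \<Longrightarrow> x ^ 2 \<in> pideal (2 * k)"
  using pideal_mult[of x k x k] by (simp add: power2_eq_square mult_2)

lemma pideal_cancel_p: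
  assumes "of_int p * x \<in> pideal (Suc k)" shows "x \<in> pideal k"
proof -
  obtain m n where n: "\<not> p dvd n" "of_int p * x = of_int (p ^ Suc k * m) / of_int n"
    using assms unfolding pideal_def by blast
  have "x = of_int (p ^ k * m) / of_int n"
  proof -
    have "of_int p * x = of_int p * (of_int (p ^ k * m) / of_int n)"
      using n(2) by simp
    thus ?thesis using p_nonzero by (subst (asm) mult_cancel_left) simp
  qed
  thus ?thesis using n(1) by (rule pidealI[rotated])
qed

lemma inverse_int_pideal_0: "\<not> p dvd n \<Longrightarrow> inverse (of_int n) \<in> pideal 0"
  by (rule pidealI[of n _ 0 1]) (auto simp: field_simps)

text \<open>If \<open>x - 1 = p m / n\<close>, then \<open>x = (n + p m) / n\<close>, and \<open>n + p m\<close> is prime to \<open>p\<close> because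
  \<open>n\<close> is.\<close>

lemma one_unit:
  assumes "x - 1 \<in> pideal 1"
  shows "x \<noteq> 0" "inverse x \<in> pideal 0" "x \<in> pideal 0"
proof -
  obtain m n where n: "\<not> p dvd n" "x - 1 = of_int (p ^ 1 * m) / of_int n"
    using assms unfolding pideal_def by blast
  have nz: "(of_int n :: rat) \<noteq> 0" using n(1) by auto
  have x: "x = of_int (n + p * m) / of_int n"
    using n(2) nz by (simp add: field_simps)
  have nd: "\<not> p dvd n + p * m" using n(1) by (simp add: dvd_add_left_iff)
  show "x \<noteq> 0" using nz not_dvd_imp_nonzero[OF nd] unfolding x by simp
  show "inverse x \<in> pideal 0"
    by (rule pidealI[OF nd, of _ 0 n]) (simp add: x)
  show "x \<in> pideal 0"
    by (rule pidealI[OF n(1), of _ 0 "n + p * m"]) (simp add: x)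
qed

lemma one_unit_mult:
  assumes "x - 1 \<in> pideal 1" "y - 1 \<in> pideal 1" shows "x * y - 1 \<in> pideal 1"
proof -
  have "x * y - 1 = (x - 1) * y + (y - 1)" by (simp add: algebra_simps)
  thus ?thesis using pideal_add pideal_mult_right one_unit(3) assms by metis
qed

text \<open>A numerator divisible by \<open>p\<^sup>k\<close> for a \<open>k\<close> larger than its absolute value must vanish.\<close>

lemma pideal_eq_zero:
  assumes "\<And>k. x \<in> pideal k" shows "x = 0"
proof (rule ccontr)
  assume "x \<noteq> 0"
  obtain a b where ab: "x = of_int a / of_int b" "b > 0"
    by (rule that[of "fst (quotient_of x)" "snd (quotient_of x)"])
      (simp_all add: quotient_of_denom_pos' quotient_of_div)
  have a: "a \<noteq> 0" using \<open>x \<noteq> 0\<close> ab by auto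
  obtain k where k: "\<bar>a\<bar> < int k" by (rule that[of "nat (\<bar>a\<bar> + 1)"]) simp
  obtain m n where n: "\<not> p dvd n" "x = of_int (p ^ k * m) / of_int n"
    using assms[of k] unfolding pideal_def by blast
  have "(of_int (a * n) :: rat) = of_int (p ^ k * m * b)"
    using ab n not_dvd_imp_nonzero[OF n(1)] by (simp add: field_simps)
  hence "a * n = p ^ k * m * b" using of_int_eq_iff by blast
  hence "p ^ k dvd a * n" by (metis dvd_triv_left mult.assoc)
  moreover have "coprime (p ^ k) n"
    using prime n(1) by (simp add: prime_imp_coprime)
  ultimately have "p ^ k dvd a" by (simp add: coprime_dvd_mult_left_iff)
  hence "p ^ k \<le> \<bar>a\<bar>" using a dvd_imp_le_int[of a "p ^ k"] by simp
  moreover have "int k < p ^ k"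
  proof -
    have "k < 2 ^ k" by (rule less_exp)
    hence "int k < 2 ^ k" by (metis of_nat_less_iff of_nat_numeral of_nat_power)
    also have "\<dots> \<le> p ^ k" using prime_ge_2_int[OF prime] by (intro power_mono) auto
    finally show ?thesis .
  qed
  ultimately show False using k by simp
qed

end

section \<open>Polynomial identities for the Edwards addition law\<close>

text \<open>Associativity of the first coordinate, with denominators cleared: \<open>(N\<^sub>i\<^sub>j / (1 + t\<^sub>i\<^sub>j),
  M\<^sub>i\<^sub>j / (1 - t\<^sub>i\<^sub>j))\<close> is the sum of the points \<open>i\<close> and \<open>j\<close>. The difference of the two
  sides lies in the ideal generated by the three curve equations; the cofactors come from division
  by these equations and their S-polynomials, after the common factor \<open>d X\<^sub>2 Y\<^sub>2\<close> of the
  difference has been split off.\<close>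

lemma edwards_assoc_identity:
  fixes a d X1 X2 X3 Y1 Y2 Y3 :: "'a::field"
  assumes e: "a * X1^2 + Y1^2 = 1 + d * X1^2 * Y1^2" "a * X2^2 + Y2^2 = 1 + d * X2^2 * Y2^2"
      "a * X3^2 + Y3^2 = 1 + d * X3^2 * Y3^2"
    and df: "N12 = X1 * Y2 + X2 * Y1" "N23 = X2 * Y3 + X3 * Y2"
      "M12 = Y1 * Y2 - a * X1 * X2" "M23 = Y2 * Y3 - a * X2 * X3"
      "t12 = d * X1 * X2 * Y1 * Y2" "t23 = d * X2 * X3 * Y2 * Y3"
  shows "(N12 * (1 - t12) * Y3 + X3 * M12 * (1 + t12)) *
        ((1 + t23) * (1 - t23) + d * X1 * Y1 * N23 * M23) =
      (N23 * (1 - t23) * Y1 + X1 * M23 * (1 + t23)) *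
        ((1 + t12) * (1 - t12) + d * X3 * Y3 * N12 * M12)"
    (is "?lhs = ?rhs")
proof -
  define c1 where "c1 = X2^2 * Y1 * Y2 * Y3^3 - X3^2 * Y1 * Y2^3 * Y3 - X2 * X3 * Y1 * Y2^2
    - X2^2 * Y1 * Y2 * Y3 + X1 * X3 * Y2^3 * Y3^2 - X1 * X2 * Y2^2 * Y3 + X1 * X2 * Y2^2 * Y3^3
    + d * X2^2 * X3^2 * Y1 * Y2^3 * Y3 + d * X2^3 * X3 * Y1 * Y2^2 * Y3^2
    - d * X1 * X2^2 * X3 * Y2^3 * Y3^2 + a * X2 * X3^3 * Y1 * Y2^2 - a * X2^3 * X3 * Y1 * Y3^2
    + a * X1 * X2^2 * X3 * Y2 + a * d * X1 * X2^3 * X3^2 * Y2^2 * Y3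
    - a^2 * X1 * X2^2 * X3^3 * Y2 - a^2 * X1 * X2^3 * X3^2 * Y3"
  define c2 where "c2 = X3^2 * Y1^3 * Y2 * Y3 - X3^2 * Y1 * Y2 * Y3 - X2 * X3 * Y1 * Y3^2
    + X2 * X3 * Y1^3 * Y3^2 + X1 * X3 * Y2 * Y3^2 - X1 * X3 * Y1^2 * Y2 * Y3^2
    + d * X1 * X3^3 * Y1^2 * Y2 * Y3^2 - d * X1 * X2 * X3^2 * Y1^2 * Y3^3
    - d * X1^2 * X3^2 * Y1 * Y2 * Y3^3 - a * X1 * X2 * X3^2 * Y3
    + a * X1 * X2 * X3^2 * Y1^2 * Y3 + a * X1^2 * X3^2 * Y1 * Y2 * Y3
    + a * X1^2 * X2 * X3 * Y1 * Y3^2 - a * X1^3 * X3 * Y2 * Y3^2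
    - a * d * X1^2 * X2 * X3^3 * Y1 * Y3^2 + a^2 * X1^3 * X2 * X3^2 * Y3"
  define c3 where "c3 = X2 * X3 * Y1 * Y2^2 - X2 * X3 * Y1^3 * Y2^2 + X2^2 * Y1 * Y2 * Y3
    - X2^2 * Y1^3 * Y2 * Y3 - X1 * X3 * Y1^2 * Y2 + X1 * X2 * Y2^2 * Y3
    + X1 * X2 * Y1^2 * Y3 - X1 * X2 * Y1^2 * Y2^2 * Y3 + X1^2 * Y1 * Y2 * Y3
    - a * X1 * X2^2 * X3 * Y2 + a * X1 * X2^2 * X3 * Y1^2 * Y2 + a * X1^2 * X2 * X3 * Y1
    - a * X1^2 * X2 * X3 * Y1 * Y2^2 - a * X1^2 * X2^2 * Y1 * Y2 * Y3
    - a * X1^3 * X2 * Y2^2 * Y3 + a^2 * X1^3 * X2^2 * X3 * Y2"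
  have "?lhs - ?rhs = d * X2 * Y2 *
      (c1 * (a * X1^2 + Y1^2 - (1 + d * X1^2 * Y1^2))
     + c2 * (a * X2^2 + Y2^2 - (1 + d * X2^2 * Y2^2))
     + c3 * (a * X3^2 + Y3^2 - (1 + d * X3^2 * Y3^2)))"
    unfolding df c1_def c2_def c3_def by algebra
  thus ?thesis unfolding e by simp
qed

text \<open>The curve equation for the sum \<open>(N / (1 + t), M / (1 - t))\<close>, with denominators cleared.\<close>

lemma edwards_closure_identity:
  fixes a d X1 X2 Y1 Y2 :: "'a::field"
  assumes e: "a * X1^2 + Y1^2 = 1 + d * X1^2 * Y1^2" "a * X2^2 + Y2^2 = 1 + d * X2^2 * Y2^2"
    and df: "N = X1 * Y2 + X2 * Y1" "M = Y1 * Y2 - a * X1 * X2" "t = d * X1 * X2 * Y1 * Y2"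
  shows "a * (N * (1 - t))^2 + (M * (1 + t))^2 = ((1 + t) * (1 - t))^2 + d * (N * M)^2"
  unfolding df using e by algebra

text \<open>The next two identities say that the Edwards sum of two points has the abscissa, respectively
  the quotient of ordinate and abscissa, that the chord construction on the cubic prescribes; the
  form in which they arise appears in the proof of \<open>cubic_x_chord\<close> below.\<close>

lemma edwards_chord_x_identity:
  fixes a d X1 X2 Y1 Y2 :: "'a::field"
  assumes e: "a * X1^2 + Y1^2 = 1 + d * X1^2 * Y1^2" "a * X2^2 + Y2^2 = 1 + d * X2^2 * Y2^2"
  shows "(a - d * Y1^2) * (a - d * Y2^2) * (X2 - X1)^2 *
        (1 - d * X1 * X2 * Y1 * Y2 - (Y1 * Y2 - a * X1 * X2)) =
      (a - d) * (Y2 - Y1)^2 * (1 - d * X1 * X2 * Y1 * Y2 + (Y1 * Y2 - a * X1 * X2))"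
  using e by algebra

lemma edwards_chord_slope_identity:
  fixes a d X1 X2 Y1 Y2 :: "'a::field"
  assumes e: "a * X1^2 + Y1^2 = 1 + d * X1^2 * Y1^2" "a * X2^2 + Y2^2 = 1 + d * X2^2 * Y2^2"
  shows "((1 + Y2) * (1 - Y1) * X1 - (1 + Y1) * (1 - Y2) * X2) *
        (1 - Y1) * (1 - Y2) * (X2 - X1) * (X1 * Y2 + X2 * Y1)
      + (a - d) * (Y2 - Y1)^2 * (X1 * X2)^2 * (X1 * Y2 + X2 * Y1)
      + 2 * X1 * X2 * (Y2 - Y1) * (1 - Y1) * (1 - Y2) * (X2 - X1) * (1 + d * X1 * X2 * Y1 * Y2)
      = 0"
  using e by algebra

section \<open>The Edwards group near its identity\<close>

locale edwards_neighbourhood = odd_prime +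
  fixes a d :: rat
  assumes a_int: "a \<in> pideal 0" and d_int: "d \<in> pideal 0"
begin

text \<open>On \<open>nbhd\<close> the denominators below are units, so division by 0 does not occur there.\<close>

fun edwards_add :: "rat \<times> rat \<Rightarrow> rat \<times> rat \<Rightarrow> rat \<times> rat" where
  "edwards_add (x1, y1) (x2, y2) =
     ((x1 * y2 + x2 * y1) / (1 + d * x1 * x2 * y1 * y2),
      (y1 * y2 - a * x1 * x2) / (1 - d * x1 * x2 * y1 * y2))"

text \<open>The points of the curve that reduce to the identity \<open>(0, 1)\<close> modulo \<open>p\<close>.\<close>

definition nbhd :: "(rat \<times> rat) set" where
  "nbhd = {(x, y). a * x^2 + y^2 = 1 + d * x^2 * y^2 \<and> x \<in> pideal 1 \<and> y - 1 \<in> pideal 1}"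

definition nbhd_group :: "(rat \<times> rat) monoid" where
  "nbhd_group = \<lparr>carrier = nbhd, mult = edwards_add, one = (0, 1)\<rparr>"

lemma nbhdD:
  assumes "(x, y) \<in> nbhd"
  shows "a * x^2 + y^2 = 1 + d * x^2 * y^2" "x \<in> pideal 1" "y - 1 \<in> pideal 1" "y \<in> pideal 0" "y \<noteq> 0" "x \<in> pideal 0"
  using assms one_unit[of y] pideal_antimono[of 0 1 x] by (auto simp: nbhd_def)

lemma half_int: "inverse 2 \<in> pideal 0"
proof -
  have "\<not> p dvd 2"
    using odd prime_ge_2_int[OF prime] zdvd_imp_le[of p 2] by force
  thus ?thesis using inverse_int_pideal_0[of 2] by simp
qed

text \<open>The sum is congruent to 2, and \<open>p\<close> is odd.\<close>

lemma sum_unit: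
  assumes "y - 1 \<in> pideal 1" "z - 1 \<in> pideal 1"
  shows "y + z \<noteq> 0" "inverse (y + z) \<in> pideal 0"
proof -
  have "(y + z) * inverse 2 - 1 = ((y - 1) + (z - 1)) * inverse 2" by (simp add: field_simps)
  also have "\<dots> \<in> pideal 1" using assms half_int by (intro pideal_mult_right pideal_add)
  finally have u: "(y + z) * inverse 2 - 1 \<in> pideal 1" .
  from one_unit(1)[OF u] show "y + z \<noteq> 0" by auto
  have "inverse (y + z) = inverse 2 * inverse ((y + z) * inverse 2)" by (simp add: field_simps)
  also have "\<dots> \<in> pideal 0" using half_int one_unit(2)[OF u] by (rule pideal_mult_left)
  finally show "inverse (y + z) \<in> pideal 0" .
qed

text \<open>The curve equation reads \<open>(y - 1) (y + 1) = x\<^sup>2 (d y\<^sup>2 - a)\<close>, and \<open>y + 1\<close> is a unit. That \<open>y\<close>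
  is 1 to second order in \<open>x\<close> is what makes addition linear up to third order below.\<close>

lemma nbhd_y_near_one:
  assumes "(x, y) \<in> nbhd" "x \<in> pideal k"
  shows "y - 1 \<in> pideal (2 * k)"
proof -
  note P = nbhdD[OF assms(1)]
  have nz: "y + 1 \<noteq> 0" "inverse (y + 1) \<in> pideal 0"
    using sum_unit[OF P(3), of 1] zero_pideal by auto
  have "(y - 1) * (y + 1) = x^2 * (d * y^2 - a)"
    using P(1) by (simp add: algebra_simps power2_eq_square)
  hence "y - 1 = x^2 * (d * (y * y) - a) * inverse (y + 1)"
    using nz(1) by (simp add: field_simps power2_eq_square)
  also have "\<dots> \<in> pideal (2 * k)"
    using assms(2) P(4) nz(2) a_int d_int by (intro pideal_mult_right pideal_power2 pideal_diff pideal_mult_left)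
  finally show ?thesis .
qed

text \<open>The curve equation determines \<open>y\<^sup>2\<close> from \<open>x\<close>, and \<open>y \<equiv> 1\<close> fixes the sign. Hence points of
  \<open>nbhd\<close> are equal once their first coordinates agree, which spares the second coordinate in the
  proof of associativity.\<close>

lemma nbhd_eq:
  assumes "(x, y) \<in> nbhd" "(x, z) \<in> nbhd"
  shows "y = z"
proof -
  note P = nbhdD[OF assms(1)] and Q = nbhdD[OF assms(2)]
  have "(1 - d * (x * x)) - 1 \<in> pideal 1"
  proof -
    have "- (d * (x * x)) \<in> pideal 1"
      using P(2,6) d_int by (intro pideal_minus pideal_mult_left)
    thus ?thesis by simp
  qed
  hence "1 - d * (x * x) \<noteq> 0" by (rule one_unit(1))
  moreover have "(1 - d * (x * x)) * (y^2 - z^2) = 0"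
    using P(1) Q(1) by algebra
  ultimately have "y^2 - z^2 = 0" by simp
  hence "(y - z) * (y + z) = 0" by (simp add: algebra_simps power2_eq_square)
  thus ?thesis using sum_unit(1)[OF P(3) Q(3)] by simp
qed

lemma denominators:
  assumes "(x1, y1) \<in> nbhd" "(x2, y2) \<in> nbhd" "x1 \<in> pideal k" "x2 \<in> pideal k"
  shows "d * x1 * x2 * y1 * y2 \<in> pideal (2 * k)"
    and "1 + d * x1 * x2 * y1 * y2 \<noteq> 0" "inverse (1 + d * x1 * x2 * y1 * y2) \<in> pideal 0"
    and "1 - d * x1 * x2 * y1 * y2 \<noteq> 0" "inverse (1 - d * x1 * x2 * y1 * y2) \<in> pideal 0"
proof -
  note P = nbhdD[OF assms(1)] and Q = nbhdD[OF assms(2)]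
  have "d * (x1 * x2) * y1 * y2 \<in> pideal (k + k)"
    using assms(3,4) P(4) Q(4) d_int by (intro pideal_mult_right pideal_mult_left pideal_mult)
  thus "d * x1 * x2 * y1 * y2 \<in> pideal (2 * k)" by (simp add: mult_2 mult.assoc)
  have "d * x1 * x2 * y1 * y2 \<in> pideal 1"
    using P(2,4,6) Q(2,4) d_int by (intro pideal_mult_right[of _ 1] pideal_mult_left)
  hence "(1 + d * x1 * x2 * y1 * y2) - 1 \<in> pideal 1" "(1 - d * x1 * x2 * y1 * y2) - 1 \<in> pideal 1"
    using pideal_minus[of "d * x1 * x2 * y1 * y2" 1] by simp_all
  from one_unit(1,2)[OF this(1)] one_unit(1,2)[OF this(2)]
  show "1 + d * x1 * x2 * y1 * y2 \<noteq> 0" "inverse (1 + d * x1 * x2 * y1 * y2) \<in> pideal 0"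
    "1 - d * x1 * x2 * y1 * y2 \<noteq> 0" "inverse (1 - d * x1 * x2 * y1 * y2) \<in> pideal 0" .
qed

lemma edwards_add_closed:
  assumes "P \<in> nbhd" "Q \<in> nbhd"
  shows "edwards_add P Q \<in> nbhd"
proof -
  obtain x1 y1 x2 y2 where PQ: "P = (x1, y1)" "Q = (x2, y2)" by fastforce
  note P = nbhdD[OF assms(1)[unfolded PQ]] and Q = nbhdD[OF assms(2)[unfolded PQ]]
  note D = denominators[OF assms[unfolded PQ] P(2) Q(2)]
  define N M t where NMt: "N = x1 * y2 + x2 * y1" "M = y1 * y2 - a * x1 * x2" "t = d * x1 * x2 * y1 * y2"
  have S: "edwards_add P Q = (N / (1 + t), M / (1 - t))"
    by (simp add: PQ NMt)
  have t: "1 + t \<noteq> 0" "1 - t \<noteq> 0" using D(2,4) by (simp_all add: NMt)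
  have "a * (N * (1 - t))^2 + (M * (1 + t))^2 = ((1 + t) * (1 - t))^2 + d * (N * M)^2"
    by (rule edwards_closure_identity[OF P(1) Q(1) NMt])
  hence "(a * (N * (1 - t))^2 + (M * (1 + t))^2) / ((1 + t) * (1 - t))^2 =
    (((1 + t) * (1 - t))^2 + d * (N * M)^2) / ((1 + t) * (1 - t))^2" by simp
  hence "a * (N / (1 + t))^2 + (M / (1 - t))^2 = 1 + d * (N / (1 + t))^2 * (M / (1 - t))^2"
    using t by (simp add: add_divide_distrib power_divide power_mult_distrib)
  moreover have "N * inverse (1 + t) \<in> pideal 1"
    using P(2,4) Q(2,4) D(3) unfolding NMt by (intro pideal_mult_right pideal_add)
  moreover have "M / (1 - t) - 1 \<in> pideal 1"
  proof -
    have "M / (1 - t) - 1 = (y1 * y2 - 1 - a * x1 * x2 + t) * inverse (1 - t)"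
      using t by (simp add: NMt field_simps)
    also have "\<dots> \<in> pideal 1"
    proof (rule pideal_mult_right)
      have "a * x1 * x2 \<in> pideal 1"
        using P(6) Q(2) a_int by (intro pideal_mult_left[of "a * x1"] pideal_mult_left[of a])
      moreover have "t \<in> pideal 1" using pideal_antimono[OF _ D(1), of 1] by (simp add: NMt)
      ultimately show "y1 * y2 - 1 - a * x1 * x2 + t \<in> pideal 1"
        using pideal_add[OF pideal_diff[OF one_unit_mult[OF P(3) Q(3)]]] by blast
    qed (use D(5) in \<open>simp add: NMt\<close>)
    finally show ?thesis .
  qed
  ultimately show ?thesis unfolding S nbhd_def by (simp add: divide_inverse)
qed

lemma edwards_add_commute: "edwards_add P Q = edwards_add Q P"
  by (cases P; cases Q) (simp add: algebra_simps)

lemma edwards_add_assoc_fst: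
  assumes "P \<in> nbhd" "Q \<in> nbhd" "R \<in> nbhd"
  shows "fst (edwards_add (edwards_add P Q) R) = fst (edwards_add P (edwards_add Q R))"
proof -
  obtain x1 y1 x2 y2 x3 y3 where PQR: "P = (x1, y1)" "Q = (x2, y2)" "R = (x3, y3)"
    by (metis surj_pair)
  note P = nbhdD[OF assms(1)[unfolded PQR]] and Q = nbhdD[OF assms(2)[unfolded PQR]]
    and R = nbhdD[OF assms(3)[unfolded PQR]]
  define N12 M12 t12 where 12: "N12 = x1 * y2 + x2 * y1" "M12 = y1 * y2 - a * x1 * x2" "t12 = d * x1 * x2 * y1 * y2"
  define N23 M23 t23 where 23: "N23 = x2 * y3 + x3 * y2" "M23 = y2 * y3 - a * x2 * x3" "t23 = d * x2 * x3 * y2 * y3"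
  have S12: "edwards_add P Q = (N12 / (1 + t12), M12 / (1 - t12))"
    and S23: "edwards_add Q R = (N23 / (1 + t23), M23 / (1 - t23))"
    by (simp_all add: PQR 12 23)
  have t: "1 + t12 \<noteq> 0" "1 - t12 \<noteq> 0" "1 + t23 \<noteq> 0" "1 - t23 \<noteq> 0"
    using denominators(2,4)[OF assms(1,2)[unfolded PQR] P(2) Q(2)]
      denominators(2,4)[OF assms(2,3)[unfolded PQR] Q(2) R(2)]
    by (simp_all add: 12 23)
  note C12 = edwards_add_closed[OF assms(1,2), unfolded S12]
  note C23 = edwards_add_closed[OF assms(2,3), unfolded S23]
  define D where "D = (1 + t12) * (1 - t12) + d * x3 * y3 * N12 * M12"
  define D' where "D' = (1 + t23) * (1 - t23) + d * x1 * y1 * N23 * M23"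
  have D_eq: "1 + d * (N12 / (1 + t12)) * x3 * (M12 / (1 - t12)) * y3 = D / ((1 + t12) * (1 - t12))"
    using t by (simp add: D_def add_divide_distrib)
  have D'_eq: "1 + d * x1 * (N23 / (1 + t23)) * y1 * (M23 / (1 - t23)) = D' / ((1 + t23) * (1 - t23))"
    using t by (simp add: D'_def add_divide_distrib)
  have nz: "D \<noteq> 0" "D' \<noteq> 0"
    using denominators(2)[OF C12 assms(3)[unfolded PQR] nbhdD(2)[OF C12] R(2)]
      denominators(2)[OF assms(1)[unfolded PQR] C23 P(2) nbhdD(2)[OF C23]]
    unfolding D_eq D'_eq by auto
  have N_eq: "N12 / (1 + t12) * y3 + x3 * (M12 / (1 - t12)) =
      (N12 * (1 - t12) * y3 + x3 * M12 * (1 + t12)) / ((1 + t12) * (1 - t12))"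
    using t by (simp add: add_divide_distrib)
  have N'_eq: "x1 * (M23 / (1 - t23)) + N23 / (1 + t23) * y1 =
      (N23 * (1 - t23) * y1 + x1 * M23 * (1 + t23)) / ((1 + t23) * (1 - t23))"
    using t by (simp add: add_divide_distrib)
  have "(N12 * (1 - t12) * y3 + x3 * M12 * (1 + t12)) * D' =
        (N23 * (1 - t23) * y1 + x1 * M23 * (1 + t23)) * D"
    unfolding D_def D'_def
    by (rule edwards_assoc_identity[OF P(1) Q(1) R(1) 12(1) 23(1) 12(2) 23(2) 12(3) 23(3)])
  hence "(N12 * (1 - t12) * y3 + x3 * M12 * (1 + t12)) / D =
      (N23 * (1 - t23) * y1 + x1 * M23 * (1 + t23)) / D'"
    using nz by (simp add: frac_eq_eq)
  thus ?thesis
    unfolding S12 S23 unfolding PQR edwards_add.simps fst_conv D_eq D'_eq N_eq N'_eq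
    using t by simp
qed

lemma edwards_add_assoc:
  assumes "P \<in> nbhd" "Q \<in> nbhd" "R \<in> nbhd"
  shows "edwards_add (edwards_add P Q) R = edwards_add P (edwards_add Q R)"
  using edwards_add_assoc_fst[OF assms] edwards_add_closed assms nbhd_eq
  by (metis prod.collapse)

lemma zero_nbhd: "(0, 1) \<in> nbhd"
  by (simp add: nbhd_def zero_pideal)

lemma nbhd_negate: "(x, y) \<in> nbhd \<Longrightarrow> (- x, y) \<in> nbhd"
  by (simp add: nbhd_def pideal_minus)

lemma edwards_add_negate:
  assumes "(x, y) \<in> nbhd" shows "edwards_add (- x, y) (x, y) = (0, 1)"
proof -
  have "edwards_add (- x, y) (x, y) \<in> nbhd"
    using assms nbhd_negate edwards_add_closed by blast
  moreover have "fst (edwards_add (- x, y) (x, y)) = 0" by simp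
  ultimately show ?thesis using nbhd_eq[OF _ zero_nbhd] by (metis prod.collapse)
qed

sublocale G: comm_group nbhd_group
proof (rule comm_groupI)
  fix P assume "P \<in> carrier nbhd_group"
  then show "\<exists>Q\<in>carrier nbhd_group. Q \<otimes>\<^bsub>nbhd_group\<^esub> P = \<one>\<^bsub>nbhd_group\<^esub>"
    using edwards_add_negate nbhd_negate by (cases P) (force simp: nbhd_group_def)
next
  fix P assume "P \<in> carrier nbhd_group"
  then show "\<one>\<^bsub>nbhd_group\<^esub> \<otimes>\<^bsub>nbhd_group\<^esub> P = P"
    by (cases P) (simp add: nbhd_group_def)
qed (simp_all add: nbhd_group_def edwards_add_closed zero_nbhd edwards_add_assoc, rule edwards_add_commute)

section \<open>Absence of torsion near the identity\<close>

text \<open>The first coordinate is a formal parameter of the group: \<open>x\<^sub>1 y\<^sub>2 + x\<^sub>2 y\<^sub>1\<close> differs from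
  \<open>x\<^sub>1 + x\<^sub>2\<close> by products of one \<open>x\<^sub>i\<close> with a \<open>y\<^sub>j - 1\<close>, hence in third order only, and
  the denominator differs from 1 by a term of second order.\<close>

lemma edwards_add_approx:
  assumes "P \<in> nbhd" "Q \<in> nbhd" "fst P \<in> pideal k" "fst Q \<in> pideal k"
  shows "fst (edwards_add P Q) - (fst P + fst Q) \<in> pideal (3 * k)"
proof -
  obtain x1 y1 x2 y2 where PQ: "P = (x1, y1)" "Q = (x2, y2)" by fastforce
  have x: "x1 \<in> pideal k" "x2 \<in> pideal k" using assms by (simp_all add: PQ)
  note D = denominators[OF assms(1,2)[unfolded PQ] x]
  define t where "t = d * x1 * x2 * y1 * y2"
  have "fst (edwards_add P Q) = (x1 * y2 + x2 * y1) / (1 + t)"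
    by (simp add: PQ t_def)
  hence "fst (edwards_add P Q) - (fst P + fst Q) =
     (x1 * ((y2 - 1) - t) + x2 * ((y1 - 1) - t)) * inverse (1 + t)"
    using D(2) unfolding t_def[symmetric] by (simp add: PQ field_simps)
  also have "\<dots> \<in> pideal (k + 2 * k)"
  proof (rule pideal_mult_right[OF pideal_add])
    show "x1 * (y2 - 1 - t) \<in> pideal (k + 2 * k)"
      using x(1) pideal_diff[OF nbhd_y_near_one[OF assms(2)[unfolded PQ] x(2)] D(1)]
      unfolding t_def by (rule pideal_mult)
    show "x2 * (y1 - 1 - t) \<in> pideal (k + 2 * k)"
      using x(2) pideal_diff[OF nbhd_y_near_one[OF assms(1)[unfolded PQ] x(1)] D(1)]
      unfolding t_def by (rule pideal_mult)
  qed (use D(3) in \<open>simp add: t_def\<close>)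
  finally show ?thesis by (simp add: add.commute)
qed

lemma pow_approx:
  assumes "P \<in> nbhd" "fst P \<in> pideal k"
  shows "fst (P [^]\<^bsub>nbhd_group\<^esub> n) \<in> pideal k \<and> fst (P [^]\<^bsub>nbhd_group\<^esub> n) - of_nat n * fst P \<in> pideal (3 * k)"
proof (induction n)
  case 0
  show ?case by (simp add: nbhd_group_def zero_pideal)
next
  case (Suc n)
  let ?Q = "P [^]\<^bsub>nbhd_group\<^esub> n"
  have Q: "?Q \<in> nbhd" using G.nat_pow_closed[of P n] assms(1) by (simp add: nbhd_group_def)
  have e: "P [^]\<^bsub>nbhd_group\<^esub> Suc n = edwards_add ?Q P"
    by (simp add: nbhd_group_def)
  have A: "fst (edwards_add ?Q P) - (fst ?Q + fst P) \<in> pideal (3 * k)"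
    using edwards_add_approx[OF Q assms(1)] Suc.IH assms(2) by blast
  have "fst (edwards_add ?Q P) = (fst (edwards_add ?Q P) - (fst ?Q + fst P)) + (fst ?Q + fst P)"
    by simp
  moreover have "\<dots> \<in> pideal k"
    using A pideal_antimono[of k "3 * k"] Suc.IH assms(2) by (intro pideal_add) auto
  moreover have "fst (edwards_add ?Q P) - of_nat (Suc n) * fst P =
      (fst (edwards_add ?Q P) - (fst ?Q + fst P)) + (fst ?Q - of_nat n * fst P)"
    by (simp add: algebra_simps)
  moreover have "\<dots> \<in> pideal (3 * k)"
    using A Suc.IH by (intro pideal_add) auto
  ultimately show ?case unfolding e by metis
qed

text \<open>Torsion is excluded by descending through the ideals without end: both cases of the argument
  below supply such a step from one ideal to the next.\<close>

lemma eq_one_if_deepening: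
  assumes "P \<in> nbhd" "\<And>k. fst P \<in> pideal (Suc k) \<Longrightarrow> fst P \<in> pideal (Suc (Suc k))"
  shows "P = \<one>\<^bsub>nbhd_group\<^esub>"
proof -
  have *: "fst P \<in> pideal (Suc k)" for k
  proof (induction k)
    case 0 show ?case using assms(1) nbhdD(2)[of "fst P" "snd P"] by simp
  qed (use assms(2) in blast)
  have "fst P \<in> pideal k" for k using pideal_antimono[OF _ *[of k], of k] by simp
  hence "fst P = 0" by (rule pideal_eq_zero)
  thus ?thesis using assms(1) nbhd_eq[OF _ zero_nbhd] by (metis prod.collapse nbhd_group_def monoid.select_convs(2))
qed

text \<open>If \<open>n\<close> kills \<open>P\<close> and \<open>p\<^sup>k\<close> divides \<open>x = X(P)\<close> with \<open>k \<ge> 1\<close>, then \<open>p\<^sup>3\<^sup>k\<close> divides \<open>n x\<close>.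
  For \<open>n\<close> prime to \<open>p\<close> and for \<open>n = p\<close> this shows that \<open>p\<^sup>k\<^sup>+\<^sup>1\<close> divides \<open>x\<close>, since
  \<open>3 k - 1 > k\<close>; so \<open>x\<close> is divisible by all powers of \<open>p\<close>. The general case reduces to these two by writing \<open>n = p m\<close>.\<close>

lemma torsion_free:
  assumes "P \<in> nbhd" "0 < n" "P [^]\<^bsub>nbhd_group\<^esub> (n :: nat) = \<one>\<^bsub>nbhd_group\<^esub>"
  shows "P = \<one>\<^bsub>nbhd_group\<^esub>"
  using assms
proof (induction n arbitrary: P rule: less_induct)
  case (less n P)
  have n_mult: "of_nat m * fst P \<in> pideal (3 * k)"
    if "P [^]\<^bsub>nbhd_group\<^esub> m = \<one>\<^bsub>nbhd_group\<^esub>" "fst P \<in> pideal k" for m k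
    using pow_approx[OF less.prems(1) that(2), of m] pideal_minus that
    by (fastforce simp: nbhd_group_def)
  define q where "q = nat p"
  have q: "int q = p" "q > 1" using prime_gt_1_int[OF prime] by (simp_all add: q_def)
  show ?case
  proof (cases "p dvd int n")
    case False
    show ?thesis
    proof (rule eq_one_if_deepening[OF less.prems(1)])
      fix k assume "fst P \<in> pideal (Suc k)"
      hence "inverse (of_int (int n)) * (of_nat n * fst P) \<in> pideal (3 * Suc k)"
        by (rule pideal_mult_left[OF inverse_int_pideal_0[OF False] n_mult[OF less.prems(3)]])
      moreover have "inverse (of_int (int n)) * (of_nat n * fst P) = fst P"
        using less.prems(2) by (simp add: field_simps)
      ultimately have "fst P \<in> pideal (3 * Suc k)" by metis
      thus "fst P \<in> pideal (Suc (Suc k))" by (rule pideal_antimono[rotated]) simp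
    qed
  next
    case True
    then obtain m where m: "n = q * m"
      using q(1) by (metis dvd_def int_dvd_int_iff)
    have m': "0 < m" "m < n" using less.prems(2) q(2) by (auto simp: m)
    have P: "P \<in> carrier nbhd_group" using less.prems(1) by (simp add: nbhd_group_def)
    have "(P [^]\<^bsub>nbhd_group\<^esub> q) [^]\<^bsub>nbhd_group\<^esub> m = \<one>\<^bsub>nbhd_group\<^esub>"
      using less.prems(3) P by (simp add: G.nat_pow_pow m)
    moreover have "P [^]\<^bsub>nbhd_group\<^esub> q \<in> nbhd"
      using G.nat_pow_closed[OF P, of q] by (simp add: nbhd_group_def)
    ultimately have "P [^]\<^bsub>nbhd_group\<^esub> q = \<one>\<^bsub>nbhd_group\<^esub>"
      using less.IH m' by blast
    note q_mult = n_mult[OF this]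
    show ?thesis
    proof (rule eq_one_if_deepening[OF less.prems(1)])
      fix k assume "fst P \<in> pideal (Suc k)"
      hence "of_int p * fst P \<in> pideal (3 * Suc k)"
        using q_mult q(1) by (metis of_int_of_nat_eq)
      hence "of_int p * fst P \<in> pideal (Suc (Suc (Suc k)))"
        by (rule pideal_antimono[rotated]) simp
      thus "fst P \<in> pideal (Suc (Suc k))" by (rule pideal_cancel_p)
    qed
  qed
qed

end

section \<open>From the Edwards curve to the cubic\<close>

lemma slope_quotient:
  fixes u s A x1 x2 :: "'a::field"
  assumes "s \<noteq> 0"
  shows "(u^2 - (A + x1 + x2) * s^2) / s^2 = (u / s)^2 - A - x1 - x2"
  using assms by (simp add: field_simps)

text \<open>As the cubic has no constant term, substituting the line \<open>y = l x + m\<close> shows that the product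
  of the three abscissas on it is \<open>m\<^sup>2\<close>. This gives a product formula for the abscissa of the sum,
  which suits the multiplicative form of \<open>x\<close> in Edwards coordinates better than the sum of the
  three roots does.\<close>

lemma cubic_third_intersection:
  fixes x1 x2 y1 y2 A B :: "'a::field"
  assumes "y1^2 = x1 * (x1^2 + A * x1 + B)" "y2^2 = x2 * (x2^2 + A * x2 + B)"
    and "x1 \<noteq> 0" "x2 \<noteq> 0" "x1 \<noteq> x2"
  shows "((y2 - y1) / (x2 - x1))^2 - A - x1 - x2 = (x1 * y2 - x2 * y1)^2 / (x1 * x2 * (x2 - x1)^2)"
proof -
  have "((y2 - y1)^2 - (A + x1 + x2) * (x2 - x1)^2) * (x1 * x2) = (x1 * y2 - x2 * y1)^2"
    using assms(1,2) by algebra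
  hence "((y2 - y1)^2 - (A + x1 + x2) * (x2 - x1)^2) / (x2 - x1)^2
      = (x1 * y2 - x2 * y1)^2 / (x1 * x2) / (x2 - x1)^2"
    using assms(3,4) by (simp add: eq_divide_eq)
  moreover have "((y2 - y1)^2 - (A + x1 + x2) * (x2 - x1)^2) / (x2 - x1)^2 =
      ((y2 - y1) / (x2 - x1))^2 - A - x1 - x2"
    using assms(5) by (intro slope_quotient) simp
  ultimately show ?thesis by simp
qed

lemma cubic_tangent_intersection:
  fixes x y A B :: "'a::field_char_0"
  assumes "y^2 = x * (x^2 + A * x + B)" "y \<noteq> 0"
  shows "((3 * x^2 + 2 * A * x + B) / (2 * y))^2 - A - x - x = ((x^2 - B) / (2 * y))^2"
proof -
  have "(3 * x^2 + 2 * A * x + B)^2 - (A + x + x) * (2 * y)^2 = (x^2 - B)^2"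
    using assms(1) by algebra
  thus ?thesis
    using slope_quotient[of "2 * y" "3 * x^2 + 2 * A * x + B" A x x] assms(2)
    by (simp only: power_divide) simp
qed

text \<open>The abscissa on the cubic as a function of the second Edwards coordinate; it inverts
  \<open>Y = (x - \<nu>) / (x + \<nu>)\<close>. The corresponding ordinate is \<open>y = x / X\<close>.\<close>

definition cubic_x :: "'a::field \<Rightarrow> 'a \<Rightarrow> 'a" where
  "cubic_x \<nu> Y = \<nu> * (1 + Y) / (1 - Y)"

lemma cubic_x_on_curve:
  fixes X Y \<nu> :: "'a::field"
  assumes e: "(1 + \<nu>)^2 * X^2 + Y^2 = 1 + (1 - \<nu>)^2 * X^2 * Y^2"
    and nz: "X \<noteq> 0" "Y \<noteq> 1"
  shows "(cubic_x \<nu> Y / X)^2 = cubic_x \<nu> Y * ((cubic_x \<nu> Y)^2 + (1 + \<nu>^2) * cubic_x \<nu> Y + \<nu>^2)"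
proof -
  define u x where "u = 1 - Y" and "x = cubic_x \<nu> Y"
  have u: "u \<noteq> 0" using nz by (simp add: u_def)
  have "x * u = \<nu> * (1 + Y)" using u by (simp add: x_def cubic_x_def u_def)
  hence "u^3 * x^2 = u^3 * (x * (x^2 + (1 + \<nu>^2) * x + \<nu>^2) * X^2)"
    using e unfolding u_def by algebra
  hence "x^2 = x * (x^2 + (1 + \<nu>^2) * x + \<nu>^2) * X^2" using u by simp
  thus ?thesis unfolding x_def[symmetric] using nz(1) by (simp add: power_divide divide_eq_eq)
qed

text \<open>For the line \<open>y = l x + m\<close> through the two points, the abscissa of their sum is
  \<open>m\<^sup>2 / (x\<^sub>1 x\<^sub>2)\<close>; in Edwards coordinates the factors \<open>1 - Y\<^sub>i\<close> cancel against the curve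
  equations. The ordinate is \<open>- (l x\<^sub>3 + m)\<close>, and \<open>m / x\<^sub>3 = x\<^sub>1 x\<^sub>2 / m\<close>, so the second claim
  amounts to \<open>l + x\<^sub>1 x\<^sub>2 / m = - 1 / X\<^sub>3\<close>.\<close>

lemma cubic_x_chord:
  fixes X1 X2 Y1 Y2 \<nu> :: "'a::field_char_0"
  defines "a \<equiv> (1 + \<nu>)^2" and "d \<equiv> (1 - \<nu>)^2"
  assumes e1: "a * X1^2 + Y1^2 = 1 + d * X1^2 * Y1^2"
    and e2: "a * X2^2 + Y2^2 = 1 + d * X2^2 * Y2^2"
    and nz: "\<nu> \<noteq> 0" "X1 \<noteq> 0" "X2 \<noteq> 0" "Y1 \<noteq> 1" "Y2 \<noteq> 1" "Y1 \<noteq> - 1" "Y2 \<noteq> - 1" "Y1 \<noteq> Y2" "X1 \<noteq> X2"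
    and D: "1 - d * X1 * X2 * Y1 * Y2 \<noteq> 0"
    and sum: "X3 = (X1 * Y2 + X2 * Y1) / (1 + d * X1 * X2 * Y1 * Y2)"
      "Y3 = (Y1 * Y2 - a * X1 * X2) / (1 - d * X1 * X2 * Y1 * Y2)"
    and nz3: "X3 \<noteq> 0" "Y3 \<noteq> 1"
    and xs: "x1 = cubic_x \<nu> Y1" "x2 = cubic_x \<nu> Y2" "y1 = x1 / X1" "y2 = x2 / X2" "x3 = cubic_x \<nu> Y3"
    and l: "l = (y2 - y1) / (x2 - x1)"
  shows "l^2 - (1 + \<nu>^2) - x1 - x2 = x3" "l * (x1 - x3) - y1 = x3 / X3"
proof -
  have ad: "a - d = 4 * \<nu>" unfolding a_def d_def by (simp add: power2_eq_square algebra_simps)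
  have u: "1 - Y1 \<noteq> 0" "1 - Y2 \<noteq> 0" "1 + Y1 \<noteq> 0" "1 + Y2 \<noteq> 0" "Y2 - Y1 \<noteq> 0" "X2 - X1 \<noteq> 0"
    using nz by (auto simp: add_eq_0_iff)
  have x0: "x1 \<noteq> 0" "x2 \<noteq> 0" using u nz(1) by (simp_all add: xs cubic_x_def)
  have x21: "x2 - x1 = 2 * \<nu> * (Y2 - Y1) / ((1 - Y1) * (1 - Y2))"
    using u(1,2) by (simp add: xs cubic_x_def field_simps)
  hence x12: "x1 \<noteq> x2" using u nz(1) by auto
  have c1: "y1^2 = x1 * (x1^2 + (1 + \<nu>^2) * x1 + \<nu>^2)"
    unfolding xs(1,3) using cubic_x_on_curve[of \<nu> X1 Y1] e1 nz unfolding a_def d_def by blast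
  have c2: "y2^2 = x2 * (x2^2 + (1 + \<nu>^2) * x2 + \<nu>^2)"
    unfolding xs(2,4) using cubic_x_on_curve[of \<nu> X2 Y2] e2 nz unfolding a_def d_def by blast
  have wr: "x1 * y2 - x2 * y1 = x1 * x2 * (X1 - X2) / (X1 * X2)"
    using nz(2,3) by (simp add: xs(3,4) field_simps)
  have x12p: "x1 * x2 = \<nu>^2 * ((1 + Y1) * (1 + Y2)) / ((1 - Y1) * (1 - Y2))"
    by (simp add: xs cubic_x_def power2_eq_square)
  have k1: "1 - Y1^2 = X1^2 * (a - d * Y1^2)" using e1 by algebra
  have k2: "1 - Y2^2 = X2^2 * (a - d * Y2^2)" using e2 by algebra
  define M where "M = Y1 * Y2 - a * X1 * X2"
  define t where "t = d * X1 * X2 * Y1 * Y2"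
  have Y3: "1 - t - M \<noteq> 0" "x3 = \<nu> * (1 - t + M) / (1 - t - M)"
  proof -
    have "1 - Y3 = (1 - t - M) / (1 - t)" "1 + Y3 = (1 - t + M) / (1 - t)"
      using D by (simp_all add: sum M_def t_def field_simps)
    thus "1 - t - M \<noteq> 0" "x3 = \<nu> * (1 - t + M) / (1 - t - M)"
      using nz3 D by (auto simp: xs cubic_x_def t_def)
  qed
  have "l^2 - (1 + \<nu>^2) - x1 - x2 = (x1 * y2 - x2 * y1)^2 / (x1 * x2 * (x2 - x1)^2)"
    unfolding l by (rule cubic_third_intersection[OF c1 c2 x0 x12])
  also have "\<dots> = x1 * x2 * (X1 - X2)^2 / ((X1 * X2)^2 * (x2 - x1)^2)"
  proof -
    have "(q * z / s)^2 / (q * r) = q * z^2 / (s^2 * r)" if "q \<noteq> 0" for q z s r :: 'a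
      using that by (simp add: power_divide power_mult_distrib power2_eq_square mult_ac)
    from this[of "x1 * x2"] show ?thesis unfolding wr using x0 by simp
  qed
  also have "\<dots> = (1 - Y1^2) * (1 - Y2^2) * (X2 - X1)^2 / (4 * (X1 * X2)^2 * (Y2 - Y1)^2)"
  proof -
    have "(1 - Y1^2) * (1 - Y2^2) = (1 + Y1) * (1 + Y2) * ((1 - Y1) * (1 - Y2))"
      by (simp add: power2_eq_square algebra_simps)
    moreover have "\<nu>^2 * A / B * Z / (s * (2 * \<nu> * D / B)^2) = A * B * Z / (4 * s * D^2)"
      if "B \<noteq> 0" for A B Z s D :: 'a
      using that nz(1) by (simp add: power_divide power_mult_distrib power2_eq_square mult_ac)
    ultimately show ?thesis unfolding x12p x21 power2_commute[of X1 X2] using u(1,2) by simp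
  qed
  also have "\<dots> = (a - d * Y1^2) * (a - d * Y2^2) * (X2 - X1)^2 / (4 * (Y2 - Y1)^2)"
    unfolding k1 k2 using nz by (simp add: power_mult_distrib)
  also have "\<dots> = x3"
  proof -
    have "(a - d * Y1^2) * (a - d * Y2^2) * (X2 - X1)^2 * (1 - t - M) = 4 * \<nu> * (Y2 - Y1)^2 * (1 - t + M)"
      unfolding ad[symmetric] M_def t_def by (rule edwards_chord_x_identity[OF e1 e2])
    thus ?thesis using u(5) Y3(1) unfolding Y3(2) by (simp add: frac_eq_eq algebra_simps)
  qed
  finally show x3: "l^2 - (1 + \<nu>^2) - x1 - x2 = x3" .
  define N where "N = X1 * Y2 + X2 * Y1"
  have N: "N \<noteq> 0" using nz3(1) by (auto simp: sum N_def)
  have X3: "X3 = N / (1 + t)" by (simp add: sum N_def t_def)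
  define m where "m = y1 - l * x1"
  have m: "m * (x2 - x1) = x1 * x2 * (X2 - X1) / (X1 * X2)"
  proof -
    have "l * (x2 - x1) = y2 - y1" using x12 by (simp add: l)
    hence "m * (x2 - x1) = x2 * y1 - x1 * y2" unfolding m_def by algebra
    also have "\<dots> = - (x1 * y2 - x2 * y1)" by simp
    also have "\<dots> = x1 * x2 * (X2 - X1) / (X1 * X2)"
      unfolding wr by (metis minus_diff_eq minus_divide_left mult_minus_right)
    finally show ?thesis .
  qed
  have m0: "m \<noteq> 0" using m x0 u(6) nz by auto
  have x3m: "x3 * (x1 * x2) = m^2"
  proof -
    have "x3 = (x1 * y2 - x2 * y1)^2 / (x1 * x2 * (x2 - x1)^2)"
      using cubic_third_intersection[OF c1 c2 x0 x12] x3 l by simp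
    moreover have "(x1 * y2 - x2 * y1)^2 = (m * (x2 - x1))^2"
      unfolding m wr by (simp add: power_divide power_mult_distrib power2_commute)
    ultimately show ?thesis using x0 x12 by (simp add: power_mult_distrib)
  qed
  have lv: "l = ((1 + Y2) * (1 - Y1) * X1 - (1 + Y1) * (1 - Y2) * X2) / (2 * X1 * X2 * (Y2 - Y1))"
  proof -
    have "y2 - y1 = \<nu> * ((1 + Y2) * (1 - Y1) * X1 - (1 + Y1) * (1 - Y2) * X2) / ((1 - Y1) * (1 - Y2) * X1 * X2)"
      using u(1,2) nz(2,3) by (simp add: xs cubic_x_def field_simps)
    thus ?thesis unfolding l x21 using u nz by simp
  qed
  have mv: "x1 * x2 / m = 2 * \<nu> * (Y2 - Y1) * X1 * X2 / ((1 - Y1) * (1 - Y2) * (X2 - X1))"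
  proof -
    have "m = x1 * x2 * (X2 - X1) / (X1 * X2) / (x2 - x1)"
      unfolding m[symmetric] using x12 by simp
    hence "x1 * x2 / m = X1 * X2 * (x2 - x1) / (X2 - X1)" using x0 by simp
    thus ?thesis unfolding x21 by (simp add: mult_ac)
  qed
  have "l + x1 * x2 / m = - ((1 + t) / N)"
  proof -
    define L where "L = (1 + Y2) * (1 - Y1) * X1 - (1 + Y1) * (1 - Y2) * X2"
    define c where "c = (1 - Y1) * (1 - Y2) * (X2 - X1)"
    define s where "s = X1 * X2 * (Y2 - Y1)"
    define K where "K = 2 * \<nu> * (Y2 - Y1) * X1 * X2"
    have nz': "c \<noteq> 0" "s \<noteq> 0" using u nz by (simp_all add: c_def s_def)
    have "L * c * N + 2 * K * s * N + 2 * s * c * (1 + t) = 0"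
      using edwards_chord_slope_identity[OF e1 e2] unfolding ad L_def c_def N_def s_def t_def K_def
      by (simp add: power2_eq_square mult_ac)
    moreover have "(L / (2 * s) + K / c) * (2 * s * c) = L * c + 2 * K * s"
      using nz' by (simp add: field_simps)
    ultimately have "(L / (2 * s) + K / c) * N * (2 * s * c) = - (1 + t) * (2 * s * c)" by algebra
    hence "(L / (2 * s) + K / c) * N = - (1 + t)" using nz' by simp
    moreover have "l = L / (2 * s)" "x1 * x2 / m = K / c"
      unfolding lv mv L_def s_def c_def K_def by (simp_all add: mult.assoc)
    ultimately show ?thesis using N by (simp add: field_simps)
  qed
  moreover have "l * (x1 - x3) - y1 = - x3 * (l + x1 * x2 / m)"
  proof -
    have "x3 * (x1 * x2 / m) = m" using x3m m0 by (simp add: power2_eq_square)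
    thus ?thesis unfolding m_def by (simp add: algebra_simps)
  qed
  ultimately show "l * (x1 - x3) - y1 = x3 / X3" unfolding X3 by simp
qed

text \<open>Here everything reduces to one consequence of the curve equation, \<open>(1 - a X\<^sup>2) (1 - Y\<^sup>2) =
  (a - d) X\<^sup>2 Y\<^sup>2\<close>: with \<open>r = (x\<^sup>2 - \<nu>\<^sup>2) / (2 y)\<close> it gives \<open>x\<^sub>3 = r\<^sup>2\<close>, \<open>l = r + 1 / X\<close> and
  \<open>x / r - l = 1 / X\<^sub>3\<close>.\<close>

lemma cubic_x_tangent:
  fixes X Y \<nu> :: "'a::field_char_0"
  defines "a \<equiv> (1 + \<nu>)^2" and "d \<equiv> (1 - \<nu>)^2"
  assumes e: "a * X^2 + Y^2 = 1 + d * X^2 * Y^2"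
    and nz: "\<nu> \<noteq> 0" "X \<noteq> 0" "Y \<noteq> 0" "Y \<noteq> 1" "Y \<noteq> - 1"
    and D: "1 - d * X * X * Y * Y \<noteq> 0"
    and sum: "X3 = (X * Y + X * Y) / (1 + d * X * X * Y * Y)"
      "Y3 = (Y * Y - a * X * X) / (1 - d * X * X * Y * Y)"
    and xs: "x = cubic_x \<nu> Y" "y = x / X" "x3 = cubic_x \<nu> Y3"
    and l: "l = (3 * x^2 + 2 * (1 + \<nu>^2) * x + \<nu>^2) / (2 * y)"
  shows "l^2 - (1 + \<nu>^2) - x - x = x3" "l * (x - x3) - y = x3 / X3"
proof -
  have ad: "a - d = 4 * \<nu>" unfolding a_def d_def by (simp add: power2_eq_square algebra_simps)
  have u: "1 - Y \<noteq> 0" "1 + Y \<noteq> 0" using nz by (auto simp: add_eq_0_iff)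
  have u2: "1 - Y^2 \<noteq> 0" using u
  proof -
    have "1 - Y^2 = (1 - Y) * (1 + Y)" by (simp add: power2_eq_square algebra_simps)
    thus ?thesis using u by simp
  qed
  have x0: "x \<noteq> 0" using u nz(1) by (simp add: xs cubic_x_def)
  hence y0: "y \<noteq> 0" using nz by (simp add: xs)
  have c: "y^2 = x * (x^2 + (1 + \<nu>^2) * x + \<nu>^2)"
    unfolding xs(1,2) using cubic_x_on_curve[of \<nu> X Y] e nz unfolding a_def d_def by blast
  have key: "(1 - a * X^2) * (1 - Y^2) = 4 * \<nu> * (X^2 * Y^2)"
    unfolding ad[symmetric] using e by algebra
  have x3v: "x3 = \<nu> * (1 - a * X^2) / (1 - Y^2)"
  proof -
    have D': "1 - d * X^2 * Y^2 \<noteq> 0" using D by (simp add: power2_eq_square mult_ac)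
    have Y3': "Y3 = (Y^2 - a * X^2) / (1 - d * X^2 * Y^2)"
      by (simp add: sum power2_eq_square mult_ac)
    have "1 - Y3 = ((1 - d * X^2 * Y^2) - (Y^2 - a * X^2)) / (1 - d * X^2 * Y^2)"
      "1 + Y3 = ((1 - d * X^2 * Y^2) + (Y^2 - a * X^2)) / (1 - d * X^2 * Y^2)"
    proof -
      have "1 - z / r = (r - z) / r" "1 + z / r = (r + z) / r" if "r \<noteq> 0" for z r :: 'a
        using that by (simp_all add: field_simps)
      from this[OF D'] show "1 - Y3 = ((1 - d * X^2 * Y^2) - (Y^2 - a * X^2)) / (1 - d * X^2 * Y^2)"
        "1 + Y3 = ((1 - d * X^2 * Y^2) + (Y^2 - a * X^2)) / (1 - d * X^2 * Y^2)"
        unfolding Y3' by blast+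
    qed
    moreover have "(1 - d * X^2 * Y^2) - (Y^2 - a * X^2) = 2 * (1 - Y^2)"
      "(1 - d * X^2 * Y^2) + (Y^2 - a * X^2) = 2 * (1 - a * X^2)"
      using e by algebra+
    moreover have "\<nu> * (2 * z / r) / (2 * w / r) = \<nu> * z / w" if "r \<noteq> 0" for z w r :: 'a
      using that by simp
    ultimately show ?thesis using D' by (simp only: xs cubic_x_def)
  qed
  have xx: "x^2 - \<nu>^2 = x * (4 * \<nu> * Y / (1 - Y^2))"
  proof -
    have "x * (1 - Y) = \<nu> * (1 + Y)" using u by (simp add: xs cubic_x_def)
    hence "(x^2 - \<nu>^2) * (1 - Y)^2 = 4 * \<nu>^2 * Y" by algebra
    hence "x^2 - \<nu>^2 = 4 * \<nu>^2 * Y / (1 - Y)^2" using u by (simp add: eq_divide_eq)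
    also have "\<dots> = x * (4 * \<nu> * Y / ((1 - Y) * (1 + Y)))"
      using u by (simp add: xs cubic_x_def power2_eq_square)
    also have "(1 - Y) * (1 + Y) = 1 - Y^2" by (simp add: power2_eq_square algebra_simps)
    finally show ?thesis .
  qed
  have q: "(x^2 - \<nu>^2) / (2 * y) = 2 * \<nu> * X * Y / (1 - Y^2)"
    unfolding xx xs(2) using x0 nz u2 by (simp add: field_simps)
  have x3q: "x3 = (2 * \<nu> * X * Y / (1 - Y^2))^2"
  proof -
    have "\<nu> * ((1 - a * X^2) * (1 - Y^2)) = (2 * \<nu> * X * Y)^2"
      unfolding key by (simp add: power2_eq_square)
    moreover have "\<nu> * (A * B) / B^2 = \<nu> * A / B" if "B \<noteq> 0" for A B :: 'a
      using that by (simp add: power2_eq_square)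
    ultimately show ?thesis using u2 unfolding x3v power_divide by metis
  qed
  show x3: "l^2 - (1 + \<nu>^2) - x - x = x3"
    unfolding l cubic_tangent_intersection[OF c y0] x3q q ..
  define r where "r = 2 * \<nu> * X * Y / (1 - Y^2)"
  have r0: "r \<noteq> 0" using nz u2 by (simp add: r_def)
  have lr: "l = r + 1 / X"
  proof -
    have "(3 * x^2 + 2 * (1 + \<nu>^2) * x + \<nu>^2) * x = (x^2 - \<nu>^2) * x + 2 * y^2"
      using c by algebra
    hence "3 * x^2 + 2 * (1 + \<nu>^2) * x + \<nu>^2 = ((x^2 - \<nu>^2) * x + 2 * y^2) / x"
      using x0 by (metis nonzero_mult_div_cancel_right)
    hence "l = ((x^2 - \<nu>^2) * x + 2 * y^2) / x / (2 * y)" by (simp only: l)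
    also have "\<dots> = (x^2 - \<nu>^2) / (2 * y) + y / x"
      using x0 y0 by (simp add: field_simps power2_eq_square)
    finally show ?thesis using x0 unfolding q r_def[symmetric] by (simp add: xs)
  qed
  have "l * (x - x3) - y = x3 * (x / r - l)"
  proof -
    have "l * x - y = r * x" using x0 nz by (simp add: lr xs field_simps)
    thus ?thesis using r0 unfolding x3q r_def[symmetric] by (simp add: algebra_simps power2_eq_square)
  qed
  also have "x / r - l = 1 / X3"
  proof -
    have xr: "x / r = (1 + Y)^2 / (2 * X * Y)"
    proof -
      have "1 - Y^2 = (1 - Y) * (1 + Y)" by (simp add: power2_eq_square algebra_simps)
      thus ?thesis using u nz by (simp add: r_def xs cubic_x_def power2_eq_square)
    qed
    have rv: "r = (1 - a * X^2) / (2 * X * Y)"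
      using key u2 nz by (simp add: r_def frac_eq_eq power2_eq_square mult_ac)
    have X3v: "1 / X3 = (a * X^2 + Y^2) / (2 * X * Y)"
      unfolding e by (simp add: sum power2_eq_square mult_ac)
    show ?thesis unfolding lr xr X3v unfolding rv using nz by (simp add: field_simps power2_eq_square)
  qed
  finally show "l * (x - x3) - y = x3 / X3" by simp
qed

section \<open>Points of infinite order and the rank\<close>

text \<open>The definitions of inverses, powers and finite products are evaluated directly in
  \<open>point_group f\<close>, which spares a proof that it is a group. The inverse of an affine point can be
  read off from the only clause of \<open>point_add\<close> that sends an affine summand to \<open>Infinity\<close>.\<close>

lemma point_group_inverse:
  assumes "R \<in> points f" "R \<noteq> Infinity"
  shows "inv\<^bsub>point_group f\<^esub> R \<noteq> Infinity" "inv\<^bsub>point_group f\<^esub> R \<in> points f"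
proof -
  obtain x y where R: "R = Affine x y" "y^2 = poly f x"
    using assms by (auto simp: points_def)
  have unique: "S = Affine x (- y)" if "point_add f R S = Infinity" for S
    using that by (cases S) (auto simp: R Let_def split: if_splits)
  have inverse: "point_add f R (Affine x (- y)) = Infinity" "point_add f (Affine x (- y)) R = Infinity"
    by (simp_all add: R)
  have mem: "Affine x (- y) \<in> points f"
    using R by (simp add: points_def)
  have "inv\<^bsub>point_group f\<^esub> R = Affine x (- y)"
    unfolding m_inv_def
  proof (rule the_equality)
    show "Affine x (- y) \<in> carrier (point_group f) \<and>
      R \<otimes>\<^bsub>point_group f\<^esub> Affine x (- y) = \<one>\<^bsub>point_group f\<^esub> \<and>
      Affine x (- y) \<otimes>\<^bsub>point_group f\<^esub> R = \<one>\<^bsub>point_group f\<^esub>"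
      using inverse mem by (simp add: point_group_def)
  qed (rule unique, simp add: point_group_def)
  thus "inv\<^bsub>point_group f\<^esub> R \<noteq> Infinity" "inv\<^bsub>point_group f\<^esub> R \<in> points f"
    using mem by simp_all
qed

text \<open>On a singleton the fold takes one step from the neutral element. This holds in any structure
  and therefore applies to \<open>point_group f\<close>.\<close>

lemma finprod_singleton_raw:
  assumes "g x \<otimes>\<^bsub>G\<^esub> \<one>\<^bsub>G\<^esub> \<in> carrier G" "\<one>\<^bsub>G\<^esub> \<in> carrier G"
  shows "finprod G g {x} = g x \<otimes>\<^bsub>G\<^esub> \<one>\<^bsub>G\<^esub>"
proof -
  let ?F = "foldSetD (carrier G) (mult G \<circ> g) \<one>\<^bsub>G\<^esub>"
  have "({x}, (mult G \<circ> g) x \<one>\<^bsub>G\<^esub>) \<in> ?F"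
    using assms by (intro foldSetD.insertI foldSetD.emptyI) auto
  moreover have "z = (mult G \<circ> g) x \<one>\<^bsub>G\<^esub>" if "({x}, z) \<in> ?F" for z
    using that
  proof cases
    case emptyI
    then show ?thesis by simp
  next
    case (insertI x' A w)
    hence "x' = x" "A = {}" by auto
    thus ?thesis using insertI by (auto elim: foldSetD.cases)
  qed
  ultimately have "foldD (carrier G) (mult G \<circ> g) \<one>\<^bsub>G\<^esub> {x} = (mult G \<circ> g) x \<one>\<^bsub>G\<^esub>"
    unfolding foldD_def by (rule the_equality)
  thus ?thesis by (simp add: finprod_def)
qed

lemma elliptic_rank_pos_if_infinite_order:
  assumes mem: "\<And>n::nat. Q [^]\<^bsub>point_group f\<^esub> n \<in> points f"
    and order: "\<And>n::nat. 0 < n \<Longrightarrow> Q [^]\<^bsub>point_group f\<^esub> n \<noteq> Infinity"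
  shows "0 < elliptic_rank f"
proof -
  let ?G = "point_group f"
  have right_zero: "point_add f R Infinity = R" for R by (cases R) auto
  have "Q [^]\<^bsub>?G\<^esub> (1::nat) = Q" by (simp add: point_group_def nat_pow_def)
  hence Q: "Q \<in> points f" using mem[of 1] by simp
  have mem_int: "Q [^]\<^bsub>?G\<^esub> k \<in> points f" for k :: int
  proof (cases "k < 0")
    case True
    thus ?thesis
      using point_group_inverse(2)[OF mem order, of "nat (- k)"] by (simp only: int_pow_def2) simp
  next
    case False
    thus ?thesis using mem[of "nat k"] by (simp only: int_pow_def2) simp
  qed
  have "k = 0" if k: "Q [^]\<^bsub>?G\<^esub> k = Infinity" for k :: int
  proof (rule ccontr)
    assume "k \<noteq> 0"
    then consider "k < 0" | "0 < k" by linarith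
    thus False
    proof cases
      case 1
      hence "0 < nat (- k)" by simp
      from point_group_inverse(1)[OF mem order[OF this]] show False
        using k 1 by (simp only: int_pow_def2 if_True)
    next
      case 2
      hence "0 < nat k" "\<not> k < 0" by simp_all
      with order k show False by (simp only: int_pow_def2 if_False)
    qed
  qed
  moreover have "finprod ?G (\<lambda>x. x [^]\<^bsub>?G\<^esub> c x) {Q} = Q [^]\<^bsub>?G\<^esub> c Q" for c :: "rat point \<Rightarrow> int"
  proof -
    have "(Q [^]\<^bsub>?G\<^esub> c Q) \<otimes>\<^bsub>?G\<^esub> \<one>\<^bsub>?G\<^esub> = Q [^]\<^bsub>?G\<^esub> c Q"
      using right_zero by (simp add: point_group_def)
    moreover have "\<one>\<^bsub>?G\<^esub> \<in> carrier ?G" "Q [^]\<^bsub>?G\<^esub> c Q \<in> carrier ?G"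
      using mem_int by (simp_all add: point_group_def points_def)
    ultimately show ?thesis
      using finprod_singleton_raw[where G = ?G and g = "\<lambda>x. x [^]\<^bsub>?G\<^esub> c x" and x = Q] by simp
  qed
  moreover have "\<one>\<^bsub>?G\<^esub> = Infinity" "carrier ?G = points f" by (simp_all add: point_group_def)
  ultimately have "int_independent ?G {Q}" using Q by (simp add: int_independent_def)
  hence "enat (card {Q}) \<le> elliptic_rank f"
    unfolding elliptic_rank_def abelian_rank_def by (intro SUP_upper) simp
  moreover have "0 < enat (card {Q})" by (simp add: zero_enat_def)
  ultimately show ?thesis by (rule less_le_trans[rotated])
qed

section \<open>The kernel of reduction on the cubic\<close>

lemma E_curve_coeff_2: "coeff (E_curve \<nu>) 2 = 1 + \<nu>^2"
  by (simp add: E_curve_def numeral_2_eq_2)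

lemma E_curve_pderiv: "poly (pderiv (E_curve \<nu>)) x = 3 * x^2 + 2 * (1 + \<nu>^2) * x + \<nu>^2"
  by (simp add: E_curve_def pderiv_pCons power2_eq_square algebra_simps)

locale curve_neighbourhood = odd_prime +
  fixes \<nu> :: rat
  assumes nu_int: "\<nu> \<in> pideal 0" and nu_nonzero: "\<nu> \<noteq> 0"
begin

sublocale edwards_neighbourhood p "(1 + \<nu>)^2" "(1 - \<nu>)^2"
proof
  show "(1 + \<nu>)^2 \<in> pideal 0" "(1 - \<nu>)^2 \<in> pideal 0"
    using pideal_power2[of _ 0] pideal_add[OF one_pideal_0 nu_int] pideal_diff[OF one_pideal_0 nu_int]
    by simp_all
qed

definition to_cubic :: "rat \<times> rat \<Rightarrow> rat point" where
  "to_cubic P = (if fst P = 0 then Infinity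
     else Affine (cubic_x \<nu> (snd P)) (cubic_x \<nu> (snd P) / fst P))"

text \<open>The points of the Edwards curve with \<open>Y = \<plusminus>1\<close> have \<open>X = 0\<close>, as \<open>a - d = 4 \<nu>\<close> is not 0.\<close>

lemma nbhd_nondegenerate:
  assumes "(X, Y) \<in> nbhd" "X \<noteq> 0"
  shows "Y \<noteq> 1" "Y \<noteq> - 1" "Y \<noteq> 0" "1 - Y^2 \<noteq> 0" "cubic_x \<nu> Y \<noteq> 0"
proof -
  have "Y^2 \<noteq> 1"
  proof
    assume "Y^2 = 1"
    hence "4 * \<nu> * X^2 = 0" using nbhdD(1)[OF assms(1)] by algebra
    thus False using assms(2) nu_nonzero by simp
  qed
  thus *: "Y \<noteq> 1" "Y \<noteq> - 1" "1 - Y^2 \<noteq> 0" by auto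
  show "Y \<noteq> 0" using nbhdD(5)[OF assms(1)] .
  show "cubic_x \<nu> Y \<noteq> 0" using * nu_nonzero by (simp add: cubic_x_def add_eq_0_iff)
qed

lemma to_cubic_points:
  assumes "P \<in> nbhd" shows "to_cubic P \<in> points (E_curve \<nu>)"
proof (cases "fst P = 0")
  case False
  obtain X Y where P: "P = (X, Y)" by fastforce
  have "(cubic_x \<nu> Y / X)^2 = cubic_x \<nu> Y * ((cubic_x \<nu> Y)^2 + (1 + \<nu>^2) * cubic_x \<nu> Y + \<nu>^2)"
    using False assms nbhdD(1)[of X Y] nbhd_nondegenerate(1)[of X Y]
    by (intro cubic_x_on_curve) (auto simp: P)
  hence "(cubic_x \<nu> Y / X)^2 = cubic_x \<nu> Y * (cubic_x \<nu> Y + 1) * (cubic_x \<nu> Y + \<nu>^2)"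
    by algebra
  thus ?thesis using False by (simp add: to_cubic_def points_E_curve P)
qed (simp add: to_cubic_def points_def)

lemma cubic_x_inj:
  assumes "cubic_x \<nu> Y = cubic_x \<nu> Z" "Y \<noteq> 1" "Z \<noteq> 1" shows "Y = Z"
proof -
  have "\<nu> * ((1 + Y) * (1 - Z)) = \<nu> * ((1 + Z) * (1 - Y))"
    using assms by (simp add: cubic_x_def frac_eq_eq mult_ac)
  hence "(1 + Y) * (1 - Z) = (1 + Z) * (1 - Y)" using nu_nonzero by simp
  thus ?thesis by (simp add: algebra_simps)
qed

text \<open>Two points with the same \<open>x\<close> have the same \<open>Y\<close>, hence \<open>X\<close> equal up to sign. So the case
  distinction of the chord-tangent law becomes: a zero summand, opposite points, equal points
  (tangent), and \<open>Y\<^sub>1 \<noteq> Y\<^sub>2\<close> (chord). In the last two cases the sum is nonzero because \<open>nbhd\<close> is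
  a group.\<close>

lemma to_cubic_add:
  assumes "P \<in> nbhd" "Q \<in> nbhd"
  shows "to_cubic (edwards_add P Q) = point_add (E_curve \<nu>) (to_cubic P) (to_cubic Q)"
proof -
  obtain X1 Y1 X2 Y2 where PQ: "P = (X1, Y1)" "Q = (X2, Y2)" by fastforce
  note P = assms(1)[unfolded PQ] and Q = assms(2)[unfolded PQ]
  have zero: "Y = 1" if "(0, Y) \<in> nbhd" for Y
    using nbhd_eq[OF that zero_nbhd] .
  have right_zero: "point_add f R Infinity = R" for f :: "rat poly" and R by (cases R) auto
  show ?thesis
  proof (cases "X1 = 0 \<or> X2 = 0")
    case True
    thus ?thesis
    proof
      assume "X1 = 0"
      moreover from this have "Y1 = 1" using zero P by blast
      ultimately show ?thesis by (simp add: PQ to_cubic_def)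
    next
      assume "X2 = 0"
      moreover from this have "Y2 = 1" using zero Q by blast
      ultimately show ?thesis by (simp add: PQ to_cubic_def[of "(0, 1)"] right_zero)
    qed
  next
    case False
    hence X: "X1 \<noteq> 0" "X2 \<noteq> 0" by auto
    note N1 = nbhd_nondegenerate[OF P X(1)] and N2 = nbhd_nondegenerate[OF Q X(2)]
    define x1 x2 where x: "x1 = cubic_x \<nu> Y1" "x2 = cubic_x \<nu> Y2"
    define y1 y2 where y: "y1 = x1 / X1" "y2 = x2 / X2"
    have x0: "x1 \<noteq> 0" "x2 \<noteq> 0" using N1(5) N2(5) by (simp_all add: x)
    have im: "to_cubic P = Affine x1 y1" "to_cubic Q = Affine x2 y2"
      using X by (simp_all add: to_cubic_def PQ x y)
    obtain X3 Y3 where S: "edwards_add P Q = (X3, Y3)" by fastforce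
    have Sn: "(X3, Y3) \<in> nbhd" using edwards_add_closed[OF assms] S by simp
    show ?thesis
    proof (cases "x1 = x2 \<and> y1 = - y2")
      case True
      hence "Y1 = Y2" using cubic_x_inj N1(1) N2(1) by (simp add: x)
      moreover have "X1 = - X2"
      proof -
        have "X2 * x2 = - (X1 * x2)" using True X by (auto simp: y field_simps)
        hence "(X1 + X2) * x2 = 0" by (simp add: algebra_simps)
        thus ?thesis using x0 by (simp add: eq_neg_iff_add_eq_0)
      qed
      ultimately have "edwards_add P Q = (0, 1)" using edwards_add_negate Q by (simp only: PQ)
      thus ?thesis using True by (simp add: im) (simp add: to_cubic_def)
    next
      case False
      have X3: "X3 \<noteq> 0"
      proof
        assume "X3 = 0"
        hence "edwards_add P Q = (0, 1)" using zero Sn S by simp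
        hence "edwards_add Q P = edwards_add (- X1, Y1) P"
          using edwards_add_negate[OF P] edwards_add_commute[of P Q] by (simp only: PQ)
        hence "Q = (- X1, Y1)"
          using G.right_cancel[of P Q "(- X1, Y1)"] P Q nbhd_negate by (simp add: nbhd_group_def PQ)
        hence "x1 = x2" "y1 = - y2" by (simp_all add: PQ x y)
        thus False using False by blast
      qed
      have Y3: "Y3 \<noteq> 1" by (rule nbhd_nondegenerate(1)[OF Sn X3])
      define x3 where "x3 = cubic_x \<nu> Y3"
      have sum: "X3 = (X1 * Y2 + X2 * Y1) / (1 + (1 - \<nu>)^2 * X1 * X2 * Y1 * Y2)"
        "Y3 = (Y1 * Y2 - (1 + \<nu>)^2 * X1 * X2) / (1 - (1 - \<nu>)^2 * X1 * X2 * Y1 * Y2)"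
        using S by (simp_all add: PQ)
      note D = denominators(4)[OF P Q nbhdD(2)[OF P] nbhdD(2)[OF Q]]
      define l where "l = (if x1 = x2 then poly (pderiv (E_curve \<nu>)) x1 / (2 * y1) else (y2 - y1) / (x2 - x1))"
      have third: "l^2 - (1 + \<nu>^2) - x1 - x2 = x3 \<and> l * (x1 - x3) - y1 = x3 / X3"
      proof (cases "Y1 = Y2")
        case True
        have "(X1^2 - X2^2) * (1 - Y1^2) = 0"
          using nbhdD(1)[OF P] nbhdD(1)[OF Q] True by algebra
        hence "X1^2 - X2^2 = 0" using N1(4) by simp
        hence "(X1 - X2) * (X1 + X2) = 0" by (simp add: power2_eq_square algebra_simps)
        moreover have "X1 \<noteq> - X2" using False True by (auto simp: x y)
        ultimately have 12: "X2 = X1" "Y2 = Y1" using True by (auto simp: eq_neg_iff_add_eq_0)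
        hence "l = (3 * x1^2 + 2 * (1 + \<nu>^2) * x1 + \<nu>^2) / (2 * y1)"
          by (simp add: l_def x E_curve_pderiv)
        from cubic_x_tangent[OF nbhdD(1)[OF P] nu_nonzero X(1) N1(3,1,2) D[unfolded 12] sum[unfolded 12] x(1) y(1) x3_def this]
        show ?thesis by (simp add: x 12)
      next
        case False
        have "X1 \<noteq> X2" using False nbhd_eq P Q by blast
        have "l = (y2 - y1) / (x2 - x1)"
          using False cubic_x_inj N1(1) N2(1) by (auto simp: l_def x)
        from cubic_x_chord[OF nbhdD(1)[OF P] nbhdD(1)[OF Q] nu_nonzero X N1(1) N2(1) N1(2) N2(2) False \<open>X1 \<noteq> X2\<close> D sum X3 Y3 x y x3_def this]
        show ?thesis by blast
      qed
      have "point_add (E_curve \<nu>) (Affine x1 y1) (Affine x2 y2) =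
          Affine (l^2 - (1 + \<nu>^2) - x1 - x2) (l * (x1 - (l^2 - (1 + \<nu>^2) - x1 - x2)) - y1)"
        using False by (simp only: point_add.simps if_False Let_def E_curve_coeff_2 l_def)
      also have "\<dots> = Affine x3 (x3 / X3)"
        by (simp only: third)
      finally have "point_add (E_curve \<nu>) (Affine x1 y1) (Affine x2 y2) = Affine x3 (x3 / X3)" .
      thus ?thesis unfolding im S using X3 by (simp add: to_cubic_def x3_def)
    qed
  qed
qed

lemma to_cubic_pow:
  assumes "P \<in> nbhd"
  shows "to_cubic (P [^]\<^bsub>nbhd_group\<^esub> n) = to_cubic P [^]\<^bsub>point_group (E_curve \<nu>)\<^esub> (n::nat)"
proof (induction n)
  case 0
  show ?case by (simp add: nbhd_group_def point_group_def to_cubic_def)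
next
  case (Suc n)
  have "P [^]\<^bsub>nbhd_group\<^esub> n \<in> nbhd"
    using G.nat_pow_closed[of P n] assms by (simp add: nbhd_group_def)
  from to_cubic_add[OF this assms] show ?case
    using Suc.IH by (simp add: nbhd_group_def point_group_def nat_pow_def)
qed

lemma positive_rank_if_nonzero_point_in_nbhd:
  assumes "(X, Y) \<in> nbhd" "X \<noteq> 0"
  shows "0 < elliptic_rank (E_curve \<nu>)"
proof (rule elliptic_rank_pos_if_infinite_order)
  fix n :: nat
  have P: "(X, Y) [^]\<^bsub>nbhd_group\<^esub> n \<in> nbhd"
    using G.nat_pow_closed[of "(X, Y)" n] assms(1) by (simp add: nbhd_group_def)
  thus "to_cubic (X, Y) [^]\<^bsub>point_group (E_curve \<nu>)\<^esub> n \<in> points (E_curve \<nu>)"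
    using to_cubic_points to_cubic_pow[OF assms(1)] by metis
  assume "0 < n"
  hence "(X, Y) [^]\<^bsub>nbhd_group\<^esub> n \<noteq> (0, 1)"
    using torsion_free[OF assms(1)] assms(2) by (fastforce simp: nbhd_group_def)
  hence "fst ((X, Y) [^]\<^bsub>nbhd_group\<^esub> n) \<noteq> 0"
    using P nbhd_eq[OF _ zero_nbhd] by (metis prod.collapse)
  hence "to_cubic ((X, Y) [^]\<^bsub>nbhd_group\<^esub> n) \<noteq> Infinity" by (simp add: to_cubic_def)
  thus "to_cubic (X, Y) [^]\<^bsub>point_group (E_curve \<nu>)\<^esub> n \<noteq> Infinity"
    by (simp only: to_cubic_pow[OF assms(1)] not_False_eq_True)
qed

end

section \<open>A dense family of curves of positive rank\<close>

text \<open>The point with abscissa \<open>16 / 9\<close> has ordinate \<open>(4/3) (5/3) (4/3) (a\<^sup>2 + b\<^sup>2) / (2 a b)\<close>. In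
  Edwards coordinates it is \<open>X = 6 a b / (5 (a\<^sup>2 + b\<^sup>2))\<close> and \<open>Y = (16 - 9 \<nu>) / (16 + 9 \<nu>)\<close>; with
  \<open>w = b\<^sup>2 - a\<^sup>2\<close>, \<open>z = a b\<close>, \<open>s = a\<^sup>2 + b\<^sup>2\<close> the congruences on \<open>a\<close> and \<open>b\<close> make 3 divide \<open>w\<close>,
  but neither \<open>z\<close> nor \<open>s\<close>. They also exclude \<open>\<nu> = 1\<close>, which would mean \<open>b = 2 a\<close>.\<close>

lemma Gamma_set_family:
  fixes a b :: int
  assumes ab: "0 < a" "a < b" and mod: "a mod 3 = 1" "b mod 3 = 1"
    and \<nu>: "\<nu> = 2 * (of_int b^2 - of_int a^2) / (3 * of_int a * of_int b)"
  shows "\<nu> \<in> Gamma_set"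
proof -
  obtain i j where ij: "a = 3 * i + 1" "b = 3 * j + 1"
    using mod by (metis mult_div_mod_eq)
  define w z s where "w = b^2 - a^2" and "z = a * b" and "s = a^2 + b^2"
  have pos: "0 < w" "0 < z" "0 < s"
    using ab by (simp_all add: w_def z_def s_def power_strict_mono add_pos_pos)
  have sq: "s^2 = w^2 + 4 * z^2"
    unfolding w_def z_def s_def by algebra
  have \<nu>_wz: "\<nu> = 2 * of_int w / (3 * of_int z)"
    by (simp add: \<nu> w_def z_def mult.assoc)
  have \<nu>_pos: "0 < \<nu>" using pos by (simp add: \<nu>_wz)
  have \<nu>_1: "\<nu> \<noteq> 1"
  proof
    assume "\<nu> = 1"
    hence "(of_int (2 * w) :: rat) = of_int (3 * z)" using pos by (simp add: \<nu>_wz field_simps)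
    hence "2 * w = 3 * z" by (simp only: of_int_eq_iff)
    hence "(b - 2 * a) * (2 * b + a) = 0" unfolding w_def z_def by algebra
    hence "b = 2 * a" using ab by simp
    thus False using mod by presburger
  qed
  have residues: "z = 3 * (3 * i * j + i + j) + 1"
    "5 * s = 3 * (5 * (3 * i^2 + 2 * i + 3 * j^2 + 2 * j) + 3) + 1"
    "8 * z + 3 * w = 3 * (8 * (3 * i * j + i + j) + 2 + w) + 2"
    unfolding z_def s_def ij by algebra+
  have remainder: "\<not> 3 dvd 3 * k + 1" "\<not> 3 dvd 3 * k + 2" for k :: int by presburger+
  have nd: "\<not> 3 dvd z" "\<not> 3 dvd 5 * s" "\<not> 3 dvd 8 * z + 3 * w"
    by (subst residues, rule remainder)+
  interpret odd_prime 3 by unfold_locales auto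
  interpret curve_neighbourhood 3 \<nu>
  proof
    have "w = 3 * (3 * j^2 + 2 * j - 3 * i^2 - 2 * i)"
      unfolding w_def ij by (simp add: power2_eq_square algebra_simps)
    then obtain c where "w = 3 * c" by blast
    hence "\<nu> = of_int (3 ^ 0 * (2 * c)) / of_int z"
      by (simp add: \<nu>_wz)
    thus "\<nu> \<in> pideal 0" by (rule pidealI[OF nd(1)])
    show "\<nu> \<noteq> 0" using \<nu>_pos by simp
  qed
  define X Y :: rat where "X = of_int (3 ^ 1 * (2 * z)) / of_int (5 * s)"
    and "Y = of_int (8 * z - 3 * w) / of_int (8 * z + 3 * w)"
  have D: "(of_int (8 * z + 3 * w) :: rat) \<noteq> 0" using pos by simp
  have "(1 + \<nu>)^2 * X^2 + Y^2 = 1 + (1 - \<nu>)^2 * X^2 * Y^2"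
  proof -
    define W Z S :: rat where "W = of_int w" and "Z = of_int z" and "S = of_int s"
    have SQ: "S^2 = W^2 + 4 * Z^2"
      unfolding W_def Z_def S_def using sq by (metis of_int_add of_int_mult of_int_numeral of_int_power)
    have nz: "Z \<noteq> 0" "S \<noteq> 0" "8 * Z + 3 * W \<noteq> 0" using pos D by (simp_all add: Z_def S_def W_def)
    have "(1 + \<nu>) * X = 2 * (3 * Z + 2 * W) / (5 * S)" "(1 - \<nu>) * X = 2 * (3 * Z - 2 * W) / (5 * S)"
      using nz by (simp_all add: \<nu>_wz X_def W_def[symmetric] Z_def[symmetric] S_def[symmetric] field_simps)
    hence PM: "(1 + \<nu>)^2 * X^2 = (2 * (3 * Z + 2 * W) / (5 * S))^2"
       "(1 - \<nu>)^2 * X^2 = (2 * (3 * Z - 2 * W) / (5 * S))^2"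
      by (metis power_mult_distrib)+
    have Y: "Y = (8 * Z - 3 * W) / (8 * Z + 3 * W)" by (simp add: Y_def W_def Z_def)
    have "(2 * (3 * Z + 2 * W))^2 * (8 * Z + 3 * W)^2 + (5 * S)^2 * (8 * Z - 3 * W)^2 =
      (5 * S)^2 * (8 * Z + 3 * W)^2 + (2 * (3 * Z - 2 * W))^2 * (8 * Z - 3 * W)^2"
      using SQ by algebra
    moreover have "p / q + r / v = 1 + t / q * (r / v)"
      if "q \<noteq> 0" "v \<noteq> 0" "p * v + q * r = q * v + t * r" for p q r v t :: rat
      using that by (simp add: field_simps)
    ultimately show ?thesis unfolding PM Y power_divide using nz by simp
  qed
  moreover have "X \<in> pideal 1" unfolding X_def by (rule pidealI[OF nd(2) refl])
  moreover have "Y - 1 \<in> pideal 1"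
  proof (rule pidealI[OF nd(3)])
    show "Y - 1 = of_int (3 ^ 1 * (- 2 * w)) / of_int (8 * z + 3 * w)"
      using D unfolding Y_def by (simp add: field_simps)
  qed
  ultimately have "(X, Y) \<in> nbhd" by (simp add: nbhd_def)
  moreover have "X \<noteq> 0" using pos by (simp add: X_def)
  ultimately show ?thesis
    using positive_rank_if_nonzero_point_in_nbhd \<nu>_pos \<nu>_1 by (simp add: Gamma_set_def)
qed

text \<open>Writing \<open>\<kappa> = a / b\<close>, the family is \<open>\<nu> = (2/3) (1/\<kappa> - \<kappa>)\<close>. Solving for \<open>\<kappa>\<close> gives the real
  number below, which is then approximated by quotients of integers congruent to 1 modulo 3. At
  \<open>n = 0\<close> both integers are 1 and \<open>\<nu>\<close> is 0, whence the restriction to \<open>n > 0\<close>.\<close>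

lemma Gamma_set_approximates:
  fixes t :: real
  assumes "0 < t"
  obtains \<nu> :: "nat \<Rightarrow> rat" where "\<And>n. 0 < n \<Longrightarrow> \<nu> n \<in> Gamma_set" "(\<lambda>n. real_of_rat (\<nu> n)) \<longlonglongrightarrow> t"
proof -
  define s where "s = 3 * t / 4"
  define \<kappa> where "\<kappa> = sqrt (s^2 + 1) - s"
  have prod: "\<kappa> * (sqrt (s^2 + 1) + s) = 1"
    by (simp add: \<kappa>_def algebra_simps power2_eq_square[symmetric])
  have s: "0 < s" using assms by (simp add: s_def)
  have "s < sqrt (s^2 + 1)" by (rule real_less_rsqrt) simp
  moreover have "sqrt (s^2 + 1) < s + 1"
    using s by (intro real_less_lsqrt) (simp_all add: power2_eq_square algebra_simps)
  ultimately have \<kappa>: "0 < \<kappa>" "\<kappa> < 1" by (simp_all add: \<kappa>_def)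
  have \<kappa>_t: "2 / 3 * (1 / \<kappa> - \<kappa>) = t"
  proof -
    have "1 / \<kappa> = sqrt (s^2 + 1) + s" using prod \<kappa> by (simp add: field_simps)
    thus ?thesis by (simp add: \<kappa>_def s_def)
  qed
  define a b :: "nat \<Rightarrow> int" where "a n = 3 * \<lfloor>n * \<kappa>\<rfloor> + 1" and "b n = 3 * int n + 1" for n
  define \<nu> :: "nat \<Rightarrow> rat" where "\<nu> n = 2 * (of_int (b n)^2 - of_int (a n)^2) / (3 * of_int (a n) * of_int (b n))" for n
  have "\<nu> n \<in> Gamma_set" if "0 < n" for n
  proof (rule Gamma_set_family[OF _ _ _ _ \<nu>_def])
    show "0 < a n" using \<kappa> by (simp add: a_def add_nonneg_pos)
    have "real n * \<kappa> < of_int (int n)" using \<kappa> that by simp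
    hence "\<lfloor>n * \<kappa>\<rfloor> < int n" by (simp only: floor_less_iff)
    thus "a n < b n" by (simp add: a_def b_def)
    show "a n mod 3 = 1" "b n mod 3 = 1" by (simp_all add: a_def b_def)
  qed
  moreover have "(\<lambda>n. real_of_rat (\<nu> n)) \<longlonglongrightarrow> t"
  proof -
    define k :: "nat \<Rightarrow> real" where "k n = of_int (a n) / of_int (b n)" for n
    have ab0: "0 < a n" "0 < b n" for n
      using \<kappa> by (simp_all add: a_def b_def add_nonneg_pos)
    have "k \<longlonglongrightarrow> \<kappa>"
    proof (rule LIM_zero_cancel, rule Lim_null_comparison)
      show "(\<lambda>n. 3 * inverse (real (Suc n))) \<longlonglongrightarrow> 0"
        by (intro tendsto_mult_right_zero LIMSEQ_inverse_real_of_nat)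
      have "norm (k n - \<kappa>) \<le> 3 * inverse (real (Suc n))" for n
      proof -
        have "k n - \<kappa> = (of_int (a n) - \<kappa> * of_int (b n)) / of_int (b n)"
          using ab0[of n] by (simp add: k_def diff_divide_distrib)
        moreover have "\<bar>of_int (a n) - \<kappa> * of_int (b n)\<bar> \<le> (3 :: real)"
        proof -
          define g where "g = real_of_int \<lfloor>n * \<kappa>\<rfloor>"
          have "g \<le> n * \<kappa>" "n * \<kappa> < g + 1" unfolding g_def by linarith+
          moreover have eq: "of_int (a n) - \<kappa> * of_int (b n) = 3 * (g - n * \<kappa>) + (1 - \<kappa>)"
            by (simp add: a_def b_def g_def algebra_simps)
          ultimately show ?thesis unfolding eq abs_le_iff using \<kappa> by (auto simp: algebra_simps)
        qed
        moreover have "real (Suc n) \<le> of_int (b n)" by (simp add: b_def)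
        ultimately have "norm (k n - \<kappa>) \<le> 3 / real (Suc n)"
          using ab0[of n] by (simp only: real_norm_def abs_divide) (intro frac_le, auto)
        thus ?thesis by (simp only: divide_inverse)
      qed
      thus "\<forall>\<^sub>F n in sequentially. norm (k n - \<kappa>) \<le> 3 * inverse (real (Suc n))" by simp
    qed
    hence "(\<lambda>n. 2 / 3 * (1 / k n - k n)) \<longlonglongrightarrow> 2 / 3 * (1 / \<kappa> - \<kappa>)"
      using \<kappa> by (intro tendsto_intros) auto
    moreover have "real_of_rat (\<nu> n) = 2 / 3 * (1 / k n - k n)" for n
      using ab0[of n] by (simp add: \<nu>_def k_def of_rat_divide of_rat_mult of_rat_diff of_rat_power field_simps power2_eq_square)
    ultimately show ?thesis by (simp only: \<kappa>_t)
  qed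
  ultimately show ?thesis by (rule that)
qed

theorem corollary4p2:
  shows "top_of_set {0<..} closure_of (real_of_rat ` Gamma_set) = ({0<..} :: real set)"
proof -
  have "t \<in> closure (real_of_rat ` Gamma_set)" if t: "0 < t" for t
  proof -
    obtain \<nu> :: "nat \<Rightarrow> rat" where \<nu>: "\<And>n. 0 < n \<Longrightarrow> \<nu> n \<in> Gamma_set"
      "(\<lambda>n. real_of_rat (\<nu> n)) \<longlonglongrightarrow> t"
      using Gamma_set_approximates[OF t] by blast
    have "(\<lambda>n. real_of_rat (\<nu> (Suc n))) \<longlonglongrightarrow> t" by (rule LIMSEQ_Suc[OF \<nu>(2)])
    moreover have "real_of_rat (\<nu> (Suc n)) \<in> real_of_rat ` Gamma_set" for n
      using \<nu>(1) by simp
    ultimately show ?thesis unfolding closure_sequential by (intro exI[of _ "\<lambda>n. real_of_rat (\<nu> (Suc n))"]) blast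
  qed
  moreover have "real_of_rat ` Gamma_set \<subseteq> {0<..}"
    by (auto simp: Gamma_set_def)
  ultimately show ?thesis
    by (auto simp: closure_of_subtopology Int_absorb1)
qed

end
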